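(* For every $n\ge 2$ the root lattice $D_n$ (with the convention that $D_2$ denotes $A_2$) has screeners which are not roots of $D_n$; those of $D_2$ have norm squared $6$ and those of $D_n$, $n\ge3$, have norm squared $4$. Precisely: (i) $D_2=A_2$ has exactly $6$ nonroot screeners, namely $$\{\pm(\alpha_1-\alpha_2),\ \pm(\alpha_1+2\alpha_2),\ \pm(2\alpha_1+\alpha_2)\},$$ which together with the roots of $A_2$ form the roots of $G_2$. (ii) $D_3=A_3$ has exactly $6$ nonroot screeners, namely $$\{\pm(\alpha_1+\alpha_2),\ \pm(\alpha_1-\alpha_2),\ \pm(\alpha_1+\alpha_2+2\alpha_3)\},$$ which together with the roots of $A_3$ form the roots of $C_3$. (iii) $D_4$ has exactly $24$ nonroot screeners, namely $$\{\pm(\alpha_i+\alpha_j),\ \alpha_i-\alpha_j,\ \pm(2\alpha_i+\alpha_j+2\alpha_3+\alpha_k),\ \pm(\alpha_i+2\alpha_3+\alpha_j)\ :\ \{i,j,k\}=\{1,2,4\}\},$$ which together with the roots of $D_4$ form the roots of $F_4$. (iv) For $n>4$, $D_n$ has exactly $2n$ nonroot screeners, namely $$\Big\{\pm(\alpha_1+\alpha_2),\ \pm(\alpha_1-\alpha_2),\ \pm\Big(\alpha_1+\alpha_2+2\sum_{i=3}^{j}\alpha_i\Big)\ :\ 3\le j\le n\Big\},$$ which together with the roots of $D_n$ form the roots of $C_n$.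
   Context: For a positive definite integral lattice $L$ with form $\langle\cdot,\cdot\rangle$, put $L^{(0)}=\{\alpha\in L:\langle\alpha,\alpha\rangle\in2\mathbb Z\}$ and $L^\circ=\{\beta\in\mathbb Q\otimes L:\langle\alpha,\beta\rangle\in\mathbb Z\ \forall\alpha\in L\}$. The set of screeners of $L$ is $\Phi=\{\beta\in L^{(0)}: \beta\notin 2L,\ 2\beta/\langle\beta,\beta\rangle\in L^\circ\}$. Root lattices are normalized so that the roots are the vectors with $\langle\alpha,\alpha\rangle=2$. For $n\ge3$, the basis $\alpha_1,\dots,\alpha_n$ of $D_n$ consists of simple roots with $\langle\alpha_i,\alpha_i\rangle=2$, $\langle\alpha_1,\alpha_2\rangle=0$, $\langle\alpha_1,\alpha_3\rangle=\langle\alpha_2,\alpha_3\rangle=-1$, $\langle\alpha_i,\alpha_{i+1}\rangle=-1$ for $3\le i\le n-1$, and all other inner products of distinct basis elements equal to $0$. For $D_2=A_2$ (a convention of the paper), $\langle\alpha_i,\alpha_i\rangle=2$ and $\langle\alpha_1,\alpha_2\rangle=-1$. *)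

theory Defs
  imports "HOL-Analysis.Analysis"
begin

section \<open>Integral lattices and screeners\<close>

text \<open>
  A positive definite integral lattice \<open>L\<close> embeds isometrically in the real inner product
  space \<open>\<real> \<otimes> L\<close>, so lattices are taken as subsets of a real inner product space: the integer
  combinations of finitely many real-linearly independent vectors. Bases are indexed by
  \<open>{1..n}\<close>.
\<close>

definition lattice_basis :: "'a::real_inner set \<Rightarrow> nat \<Rightarrow> (nat \<Rightarrow> 'a) \<Rightarrow> bool" where
  "lattice_basis L n \<alpha> \<longleftrightarrow>
     inj_on \<alpha> {1..n} \<and> independent (\<alpha> ` {1..n}) \<and>
     L = {\<Sum>i=1..n. of_int (c i) *\<^sub>R \<alpha> i | c :: nat \<Rightarrow> int. True}"

definition integral_lattice :: "'a::real_inner set \<Rightarrow> bool" where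
  "integral_lattice L \<longleftrightarrow>
     (\<exists>n \<alpha>. lattice_basis L n \<alpha>) \<and> (\<forall>x\<in>L. \<forall>y\<in>L. x \<bullet> y \<in> \<int>)"

definition even_sublattice :: "'a::real_inner set \<Rightarrow> 'a set" where
  "even_sublattice L = {\<alpha> \<in> L. \<exists>k::int. \<alpha> \<bullet> \<alpha> = 2 * of_int k}"

text \<open>
  Clearing denominators, every element of \<open>\<rat> \<otimes> L\<close> is a single rational multiple of an
  element of \<open>L\<close>.
\<close>

definition rational_hull :: "'a::real_inner set \<Rightarrow> 'a set" where
  "rational_hull L = {q *\<^sub>R x | q x. q \<in> \<rat> \<and> x \<in> L}"

definition dual_lattice :: "'a::real_inner set \<Rightarrow> 'a set" where
  "dual_lattice L = {\<beta> \<in> rational_hull L. \<forall>\<alpha>\<in>L. \<alpha> \<bullet> \<beta> \<in> \<int>}"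

text \<open>
  The zero vector lies in \<open>2L\<close>, so the division by \<open>\<beta> \<bullet> \<beta>\<close> is only relevant for nonzero \<open>\<beta>\<close>.
\<close>

definition screeners :: "'a::real_inner set \<Rightarrow> 'a set" where
  "screeners L = {\<beta> \<in> even_sublattice L.
     \<beta> \<notin> (\<lambda>x. 2 *\<^sub>R x) ` L \<and> (2 / (\<beta> \<bullet> \<beta>)) *\<^sub>R \<beta> \<in> dual_lattice L}"

definition lattice_roots :: "'a::real_inner set \<Rightarrow> 'a set" where
  "lattice_roots L = {\<alpha> \<in> L. \<alpha> \<bullet> \<alpha> = 2}"

definition nonroot_screeners :: "'a::real_inner set \<Rightarrow> 'a set" where
  "nonroot_screeners L = screeners L - lattice_roots L"


section \<open>The root lattices of type A and D\<close>

definition gram_A :: "nat \<Rightarrow> nat \<Rightarrow> real" where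
  "gram_A i j = (if i = j then 2 else if j = Suc i \<or> i = Suc j then -1 else 0)"

text \<open>
  Here \<open>\<alpha>\<^sub>1\<close> and \<open>\<alpha>\<^sub>2\<close> are the two ends of the fork, both attached to \<open>\<alpha>\<^sub>3\<close>, and
  \<open>\<alpha>\<^sub>3, \<dots>, \<alpha>\<^sub>n\<close> is a chain.
\<close>

definition gram_D :: "nat \<Rightarrow> nat \<Rightarrow> real" where
  "gram_D i j =
     (if i = j then 2
      else if {i, j} = {1, 3} \<or> {i, j} = {2, 3} \<or> (\<exists>k\<ge>3. {i, j} = {k, Suc k}) then -1
      else 0)"

definition A_lattice :: "'a::real_inner set \<Rightarrow> nat \<Rightarrow> (nat \<Rightarrow> 'a) \<Rightarrow> bool" where
  "A_lattice L n \<alpha> \<longleftrightarrow>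
     lattice_basis L n \<alpha> \<and> (\<forall>i\<in>{1..n}. \<forall>j\<in>{1..n}. \<alpha> i \<bullet> \<alpha> j = gram_A i j)"

text \<open>The convention \<open>D\<^sub>2 = A\<^sub>2\<close> is in force (rather than \<open>D\<^sub>2 = A\<^sub>1 + A\<^sub>1\<close>).\<close>

definition D_lattice :: "'a::real_inner set \<Rightarrow> nat \<Rightarrow> (nat \<Rightarrow> 'a) \<Rightarrow> bool" where
  "D_lattice L n \<alpha> \<longleftrightarrow>
     (if n = 2 then A_lattice L 2 \<alpha>
      else n \<ge> 3 \<and> lattice_basis L n \<alpha> \<and>
        (\<forall>i\<in>{1..n}. \<forall>j\<in>{1..n}. \<alpha> i \<bullet> \<alpha> j = gram_D i j))"

lemma integer_combinations_integral:
  fixes \<alpha> :: "nat \<Rightarrow> 'a::real_inner"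
  assumes "lattice_basis L n \<alpha>"
    and "\<And>i j. i \<in> {1..n} \<Longrightarrow> j \<in> {1..n} \<Longrightarrow> \<alpha> i \<bullet> \<alpha> j \<in> \<int>"
  shows "integral_lattice L"
  unfolding integral_lattice_def
proof (intro conjI ballI)
  show "\<exists>n \<alpha>. lattice_basis L n \<alpha>"
    using assms(1) by blast
next
  fix x y assume "x \<in> L" "y \<in> L"
  then obtain c d :: "nat \<Rightarrow> int"
    where "x = (\<Sum>i=1..n. of_int (c i) *\<^sub>R \<alpha> i)" "y = (\<Sum>i=1..n. of_int (d i) *\<^sub>R \<alpha> i)"
    using assms(1) unfolding lattice_basis_def by auto
  then have "x \<bullet> y = (\<Sum>i=1..n. \<Sum>j=1..n. of_int (d i) * (of_int (c j) * (\<alpha> j \<bullet> \<alpha> i)))"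
    by (simp add: inner_sum_left inner_sum_right sum_distrib_left)
  also have "\<dots> \<in> \<int>"
    using assms(2) by (intro Ints_sum Ints_mult Ints_of_int) auto
  finally show "x \<bullet> y \<in> \<int>" .
qed

lemma D_lattice_integral: "integral_lattice L" if "D_lattice L n \<alpha>"
proof (cases "n = 2")
  case True
  with that have "lattice_basis L 2 \<alpha>" "\<forall>i\<in>{1..2}. \<forall>j\<in>{1..2}. \<alpha> i \<bullet> \<alpha> j = gram_A i j"
    by (simp_all add: D_lattice_def A_lattice_def)
  then show ?thesis
    by (intro integer_combinations_integral[of L 2 \<alpha>]) (simp_all add: gram_A_def)
next
  case False
  with that have "lattice_basis L n \<alpha>" "\<forall>i\<in>{1..n}. \<forall>j\<in>{1..n}. \<alpha> i \<bullet> \<alpha> j = gram_D i j"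
    by (simp_all add: D_lattice_def)
  then show ?thesis
    by (intro integer_combinations_integral[of L n \<alpha>]) (simp_all add: gram_D_def)
qed

text \<open>
  Realizations of \<open>D\<^sub>n\<close> exist for every \<open>n \<ge> 2\<close>: in a space of dimension \<open>n\<close> with orthonormal
  basis \<open>e\<^sub>1, \<dots>, e\<^sub>n\<close> one may take \<open>\<alpha>\<^sub>1 = - e\<^sub>1 - e\<^sub>2\<close> and \<open>\<alpha>\<^sub>i = e\<^sub>i\<^sub>-\<^sub>1 - e\<^sub>i\<close> if \<open>n \<ge> 3\<close>.
\<close>

lemma lattice_basisI_spanning:
  fixes \<alpha> :: "nat \<Rightarrow> 'a::euclidean_space"
  assumes "inj_on \<alpha> {1..n}" "DIM('a) = n" "Basis \<subseteq> span (\<alpha> ` {1..n})"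
  shows "lattice_basis {\<Sum>i=1..n. of_int (c i) *\<^sub>R \<alpha> i | c :: nat \<Rightarrow> int. True} n \<alpha>"
proof -
  have "UNIV \<subseteq> span (\<alpha> ` {1..n})"
    using span_minimal[OF assms(3) subspace_span] by simp
  moreover have "card (\<alpha> ` {1..n}) = DIM('a)"
    using assms(1,2) by (simp add: card_image)
  ultimately have "independent (\<alpha> ` {1..n})"
    by (intro card_le_dim_spanning[where V = UNIV]) auto
  with assms(1) show ?thesis
    by (simp add: lattice_basis_def)
qed

lemma D_lattice_exists:
  assumes "DIM('a::euclidean_space) = n" "n \<ge> 2"
  shows "\<exists>(L :: 'a set) \<alpha>. D_lattice L n \<alpha>"
proof -
  have "\<exists>e. bij_betw e {1..card (Basis :: 'a set)} (Basis :: 'a set)"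
    by (rule ex_bij_betw_nat_finite_1) simp
  then obtain e :: "nat \<Rightarrow> 'a" where e: "bij_betw e {1..n} Basis"
    unfolding assms(1) by blast
  have ee: "e i \<bullet> e j = (if i = j then 1 else 0)" if "i \<in> {1..n}" "j \<in> {1..n}" for i j
  proof -
    have "e i \<in> Basis" "e j \<in> Basis" "e i = e j \<longleftrightarrow> i = j"
      using that e by (auto simp only: bij_betw_def inj_on_def image_iff)
    then show ?thesis by (simp add: inner_Basis)
  qed
  have Basis: "Basis = e ` {1..n}"
    using e by (simp add: bij_betw_def)
  show ?thesis
  proof (cases "n = 2")
    case True
    define \<alpha> where
      "\<alpha> i = (if i = 1 then sqrt 2 *\<^sub>R e 1 else - sqrt (1/2) *\<^sub>R e 1 + sqrt (3/2) *\<^sub>R e 2)" for i :: nat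
    have s: "sqrt 2 * sqrt (1/2) = 1" "sqrt (1/2) * sqrt 2 = 1"
      by (simp_all flip: real_sqrt_mult)
    have gram: "\<alpha> i \<bullet> \<alpha> j = gram_A i j" if "i \<in> {1..2}" "j \<in> {1..2}" for i j
    proof -
      have ij: "i = 1 \<or> i = 2" "j = 1 \<or> j = 2"
        using that by auto
      have o: "e 1 \<bullet> e 1 = 1" "e 2 \<bullet> e 2 = 1" "e 1 \<bullet> e 2 = 0" "e 2 \<bullet> e 1 = 0"
        using ee True by auto
      have "\<alpha> 1 \<bullet> \<alpha> 1 = 2" "\<alpha> 2 \<bullet> \<alpha> 2 = 2" "\<alpha> 1 \<bullet> \<alpha> 2 = - 1" "\<alpha> 2 \<bullet> \<alpha> 1 = - 1"
        unfolding \<alpha>_def using o s by (simp_all add: inner_add_left inner_add_right inner_diff_left inner_diff_right)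
      with ij show ?thesis by (auto simp: gram_A_def)
    qed
    have "inj_on \<alpha> {1..n}"
    proof (rule inj_onI)
      fix i j assume "i \<in> {1..n}" "j \<in> {1..n}" "\<alpha> i = \<alpha> j"
      with gram[of i i] gram[of i j] True have "gram_A i j = gram_A i i" by simp
      then show "i = j" by (simp add: gram_A_def split: if_splits)
    qed
    moreover have "Basis \<subseteq> span (\<alpha> ` {1..n})"
    proof -
      let ?S = "span (\<alpha> ` {1..n})"
      have a: "\<alpha> 1 \<in> ?S" "\<alpha> 2 \<in> ?S" using True by (auto intro!: span_base)
      have "e 1 = (1 / sqrt 2) *\<^sub>R \<alpha> 1" by (simp add: \<alpha>_def)
      then have e1: "e 1 \<in> ?S" using a(1) by (metis span_scale)
      have "e 2 = (1 / sqrt (3/2)) *\<^sub>R (\<alpha> 2 + sqrt (1/2) *\<^sub>R e 1)" by (simp add: \<alpha>_def)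
      then have "e 2 \<in> ?S" using a(2) e1 by (metis span_scale span_add)
      moreover have "{1..n} = {1, 2}" using True by auto
      ultimately show ?thesis using e1 by (simp add: Basis)
    qed
    ultimately have "lattice_basis {\<Sum>i=1..n. of_int (c i) *\<^sub>R \<alpha> i | c :: nat \<Rightarrow> int. True} n \<alpha>"
      using assms(1) by (intro lattice_basisI_spanning)
    then have "D_lattice {\<Sum>i=1..n. of_int (c i) *\<^sub>R \<alpha> i | c :: nat \<Rightarrow> int. True} n \<alpha>"
      using gram True by (simp add: D_lattice_def A_lattice_def)
    then show ?thesis by blast
  next
    case False
    with assms(2) have n: "n \<ge> 3" by simp
    define \<alpha> where "\<alpha> i = (if i = 1 then - e 1 - e 2 else e (i - 1) - e i)" for i :: nat
    have gram: "\<alpha> i \<bullet> \<alpha> j = gram_D i j" if "i \<in> {1..n}" "j \<in> {1..n}" for i j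
    proof -
      have chain: "(\<exists>k\<ge>3. {i, j} = {k, Suc k}) \<longleftrightarrow> i \<ge> 3 \<and> j = Suc i \<or> j \<ge> 3 \<and> i = Suc j"
        by (auto simp: doubleton_eq_iff)
      have one: "1 \<in> {1..n}" "2 \<in> {1..n}" using n by auto
      consider "i = 1" "j = 1" | "i = 1" "j \<ge> 2" | "i \<ge> 2" "j = 1" | "i \<ge> 2" "j \<ge> 2"
        using \<open>i \<in> {1..n}\<close> \<open>j \<in> {1..n}\<close> by fastforce
      then show ?thesis
      proof cases
        case 1
        then show ?thesis using one
          by (simp add: \<alpha>_def gram_D_def inner_diff_left inner_diff_right ee)
      next
        case 2
        then have "j - 1 \<in> {1..n}" using that by auto
        with 2 that one show ?thesis
          by (auto simp: \<alpha>_def gram_D_def chain doubleton_eq_iff inner_diff_left inner_diff_right ee)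
      next
        case 3
        then have "i - 1 \<in> {1..n}" using that by auto
        with 3 that one show ?thesis
          by (auto simp: \<alpha>_def gram_D_def chain doubleton_eq_iff inner_diff_left inner_diff_right ee)
      next
        case 4
        then obtain p q where pq: "i = Suc p" "j = Suc q" "p \<ge> 1" "q \<ge> 1"
          by (metis One_nat_def Suc_le_D Suc_le_mono numeral_2_eq_2)
        then have "gram_D i j = (if p = q then 2 else if q = Suc p \<or> p = Suc q then -1 else 0)"
          unfolding gram_D_def chain by (simp add: doubleton_eq_iff) linarith
        moreover have "\<alpha> i \<bullet> \<alpha> j = e p \<bullet> e q - e p \<bullet> e (Suc q) - (e (Suc p) \<bullet> e q - e (Suc p) \<bullet> e (Suc q))"
          using pq by (simp add: \<alpha>_def inner_diff_left inner_diff_right)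
        moreover have "p \<in> {1..n}" "Suc p \<in> {1..n}" "q \<in> {1..n}" "Suc q \<in> {1..n}"
          using pq that by simp_all
        ultimately show ?thesis by (simp add: ee)
      qed
    qed
    have "inj_on \<alpha> {1..n}"
    proof (rule inj_onI)
      fix i j assume "i \<in> {1..n}" "j \<in> {1..n}" "\<alpha> i = \<alpha> j"
      with gram[of i i] gram[of i j] have "gram_D i j = gram_D i i" by simp
      then show "i = j" by (simp add: gram_D_def split: if_splits)
    qed
    moreover have "Basis \<subseteq> span (\<alpha> ` {1..n})"
    proof -
      let ?S = "span (\<alpha> ` {1..n})"
      have a: "\<alpha> i \<in> ?S" if "i \<in> {1..n}" for i using that by (auto intro!: span_base)
      have "e 1 = (1/2) *\<^sub>R (\<alpha> 2 - \<alpha> 1)"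
        by (simp add: \<alpha>_def flip: scaleR_2)
      then have e1: "e 1 \<in> ?S" using a[of 1] a[of 2] n
        by (metis atLeastAtMost_iff assms(2) le_refl one_le_numeral order_trans span_scale span_diff)
      have "i \<le> n \<longrightarrow> e i \<in> ?S" if "i \<ge> 1" for i
        using that
      proof (induction i rule: dec_induct)
        case base
        then show ?case using e1 by simp
      next
        case (step m)
        then have "e (Suc m) = e m - \<alpha> (Suc m)" by (simp add: \<alpha>_def)
        with step a[of "Suc m"] show ?case by (auto intro: span_diff)
      qed
      then show ?thesis by (auto simp: Basis)
    qed
    ultimately have "lattice_basis {\<Sum>i=1..n. of_int (c i) *\<^sub>R \<alpha> i | c :: nat \<Rightarrow> int. True} n \<alpha>"
      using assms(1) by (intro lattice_basisI_spanning)
    then have "D_lattice {\<Sum>i=1..n. of_int (c i) *\<^sub>R \<alpha> i | c :: nat \<Rightarrow> int. True} n \<alpha>"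
      using gram False n by (simp add: D_lattice_def)
    then show ?thesis by blast
  qed
qed


section \<open>Root systems and their types\<close>

text \<open>
  Reduced crystallographic root systems, regarded as root systems in their own real span.
\<close>

definition root_system :: "'a::real_inner set \<Rightarrow> bool" where
  "root_system R \<longleftrightarrow>
     finite R \<and> 0 \<notin> R \<and>
     (\<forall>\<alpha>\<in>R. \<forall>c::real. c *\<^sub>R \<alpha> \<in> R \<longrightarrow> c = 1 \<or> c = -1) \<and>
     (\<forall>\<alpha>\<in>R. \<forall>\<beta>\<in>R. 2 * (\<beta> \<bullet> \<alpha>) / (\<alpha> \<bullet> \<alpha>) \<in> \<int> \<and>
        \<beta> - (2 * (\<beta> \<bullet> \<alpha>) / (\<alpha> \<bullet> \<alpha>)) *\<^sub>R \<alpha> \<in> R)"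

definition simple_roots :: "'a::real_inner set \<Rightarrow> nat \<Rightarrow> (nat \<Rightarrow> 'a) \<Rightarrow> bool" where
  "simple_roots R n \<delta> \<longleftrightarrow>
     inj_on \<delta> {1..n} \<and> \<delta> ` {1..n} \<subseteq> R \<and> independent (\<delta> ` {1..n}) \<and>
     (\<forall>\<beta>\<in>R. \<exists>c :: nat \<Rightarrow> nat.
        \<beta> = (\<Sum>i=1..n. of_nat (c i) *\<^sub>R \<delta> i) \<or> \<beta> = - (\<Sum>i=1..n. of_nat (c i) *\<^sub>R \<delta> i))"

text \<open>
  Cartan matrices follow the convention
  \<open>C i j = 2 (\<delta>\<^sub>i \<bullet> \<delta>\<^sub>j) / (\<delta>\<^sub>j \<bullet> \<delta>\<^sub>j)\<close> and the numbering of Bourbaki.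
\<close>

definition root_system_of_type ::
    "'a::real_inner set \<Rightarrow> nat \<Rightarrow> (nat \<Rightarrow> nat \<Rightarrow> int) \<Rightarrow> bool" where
  "root_system_of_type R n C \<longleftrightarrow>
     root_system R \<and>
     (\<exists>\<delta>. simple_roots R n \<delta> \<and>
       (\<forall>i\<in>{1..n}. \<forall>j\<in>{1..n}. 2 * (\<delta> i \<bullet> \<delta> j) / (\<delta> j \<bullet> \<delta> j) = of_int (C i j)))"

definition cartan_C :: "nat \<Rightarrow> nat \<Rightarrow> nat \<Rightarrow> int" where
  "cartan_C n i j =
     (if i = j then 2
      else if i = n \<and> Suc j = n then -2
      else if j = Suc i \<or> i = Suc j then -1
      else 0)"

definition cartan_F4 :: "nat \<Rightarrow> nat \<Rightarrow> int" where
  "cartan_F4 i j =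
     (if i = j then 2
      else if i = 2 \<and> j = 3 then -2
      else if j = Suc i \<or> i = Suc j then -1
      else 0)"

definition cartan_G2 :: "nat \<Rightarrow> nat \<Rightarrow> int" where
  "cartan_G2 i j = (if i = j then 2 else if i = 2 \<and> j = 1 then -3 else -1)"

end

(*
  Every root is a screener, and the reflection in a screener preserves the lattice, hence permutes
  the screeners; so the screeners of an integral lattice form a root system. To find them, use that
  the norm of b times the norm of 2b/<b,b> is 4, where 2b/<b,b> lies in the dual lattice. In the
  orthonormal coordinates of D_n this leaves only the norms 2 and 4, and a vector of norm 4 is a
  screener iff its coordinates are congruent modulo 2: these are the vectors 2e and -2e for e in the
  orthonormal basis and, for n = 4 only, the sixteen sign vectors. The type is read off from an
  explicit base, a set spanning the lattice's basis with coefficients of constant sign on each root.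
*)

theory Submission
  imports Defs
begin

section \<open>Lattices, screeners and their reflections\<close>

text \<open>Each clause in the definition of a screener supplies one root system axiom. The dual
  lattice clause is the integrality of the Cartan numbers, and the exclusion of \<open>2L\<close>
  makes the system reduced: among proportional screeners the ratios 2, -2, 1/2 and -1/2 would put
  one of the two vectors into \<open>2L\<close>. The ambient space is an arbitrary real inner
  product space, so no orthonormal basis is given. The vectors \<open>e i\<close> are solved for
  from the Gram matrix of the simple roots, and independence of a base follows by counting rather
  than by dimension. The case n = 4 is exceptional because coordinates of equal parity may all be
  odd: n odd squares with sum 4 require n = 4 once n is at least 3. The frame needs n at least 3, so
  A_2 is treated separately in the coordinates of its simple roots. The constant signs come from
  partial sums of coordinates in type C, and from finite checks over coordinates of absolute value
  at most 2 in types F and G.\<close>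

lemma lattice_basis_subset:
  assumes "lattice_basis L n \<alpha>"
    and "\<And>i. i \<in> {1..n} \<Longrightarrow> \<alpha> i \<in> M" "0 \<in> M"
    and add: "\<And>x y. x \<in> M \<Longrightarrow> y \<in> M \<Longrightarrow> x + y \<in> M"
    and scale: "\<And>k x. x \<in> M \<Longrightarrow> of_int k *\<^sub>R x \<in> M"
  shows "L \<subseteq> M"
proof
  fix x assume "x \<in> L"
  then obtain c :: "nat \<Rightarrow> int" where "x = (\<Sum>i=1..n. of_int (c i) *\<^sub>R \<alpha> i)"
    using assms(1) by (auto simp: lattice_basis_def)
  moreover have "(\<Sum>i\<in>I. of_int (c i) *\<^sub>R \<alpha> i) \<in> M" if "finite I" "I \<subseteq> {1..n}" for I
    using that by (induction I rule: finite_induct) (auto intro!: assms)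
  ultimately show "x \<in> M" by blast
qed

lemma lattice_basis_memI:
  assumes "lattice_basis L n \<alpha>" "x = (\<Sum>i=1..n. of_int (c i) *\<^sub>R \<alpha> i)"
  shows "x \<in> L"
  using assms by (auto simp: lattice_basis_def)

lemma lattice_basis_mem:
  assumes "lattice_basis L n \<alpha>" "i \<in> {1..n}"
  shows "\<alpha> i \<in> L"
proof -
  have "\<alpha> i = (\<Sum>k=1..n. of_int (if k = i then 1 else 0) *\<^sub>R \<alpha> k)"
    using assms(2) by (simp add: if_distrib[of "\<lambda>c. of_int c *\<^sub>R _"] cong: if_cong)
  then show ?thesis
    by (rule lattice_basis_memI[OF assms(1)])
qed

lemma lattice_basis_add:
  assumes "lattice_basis L n \<alpha>" "x \<in> L" "y \<in> L"
  shows "x + y \<in> L"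
proof -
  obtain c d :: "nat \<Rightarrow> int" where "x = (\<Sum>i=1..n. of_int (c i) *\<^sub>R \<alpha> i)"
      "y = (\<Sum>i=1..n. of_int (d i) *\<^sub>R \<alpha> i)"
    using assms by (auto simp: lattice_basis_def)
  then have "x + y = (\<Sum>i=1..n. of_int (c i + d i) *\<^sub>R \<alpha> i)"
    by (simp add: scaleR_add_left sum.distrib)
  then show ?thesis
    by (rule lattice_basis_memI[OF assms(1)])
qed

lemma lattice_basis_scale:
  assumes "lattice_basis L n \<alpha>" "x \<in> L"
  shows "of_int k *\<^sub>R x \<in> L"
proof -
  obtain c :: "nat \<Rightarrow> int" where "x = (\<Sum>i=1..n. of_int (c i) *\<^sub>R \<alpha> i)"
    using assms by (auto simp: lattice_basis_def)
  then have "of_int k *\<^sub>R x = (\<Sum>i=1..n. of_int (k * c i) *\<^sub>R \<alpha> i)"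
    by (simp add: scaleR_sum_right)
  then show ?thesis
    by (rule lattice_basis_memI[OF assms(1)])
qed

lemma integral_lattice_closed:
  assumes "integral_lattice L"
  shows "x \<in> L \<Longrightarrow> y \<in> L \<Longrightarrow> x + y \<in> L"
    and "x \<in> L \<Longrightarrow> of_int k *\<^sub>R x \<in> L"
    and "x \<in> L \<Longrightarrow> y \<in> L \<Longrightarrow> x - y \<in> L"
    and "x \<in> L \<Longrightarrow> y \<in> L \<Longrightarrow> x \<bullet> y \<in> \<int>"
proof -
  obtain n \<alpha> where L: "lattice_basis L n \<alpha>"
    using assms by (auto simp: integral_lattice_def)
  show "x \<in> L \<Longrightarrow> y \<in> L \<Longrightarrow> x + y \<in> L" "x \<in> L \<Longrightarrow> of_int k *\<^sub>R x \<in> L"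
    using lattice_basis_add[OF L] lattice_basis_scale[OF L] by auto
  show "x - y \<in> L" if "x \<in> L" "y \<in> L"
    using lattice_basis_add[OF L that(1) lattice_basis_scale[OF L that(2), of "-1"]] by simp
  show "x \<in> L \<Longrightarrow> y \<in> L \<Longrightarrow> x \<bullet> y \<in> \<int>"
    using assms by (auto simp: integral_lattice_def)
qed

lemma orthogonal_lattice_basis:
  assumes "lattice_basis L n \<alpha>" "x \<in> L" "\<And>i. i \<in> {1..n} \<Longrightarrow> x \<bullet> \<alpha> i = 0"
  shows "x = 0"
proof -
  have "L \<subseteq> {y. x \<bullet> y = 0}"
    by (rule lattice_basis_subset[OF assms(1)]) (use assms(3) in \<open>auto simp: inner_add_right\<close>)
  then show ?thesis using assms(2) by auto
qed

text \<open>The norm of a lattice vector is an integer, so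
  \<open>2 / (\<beta> \<bullet> \<beta>)\<close> is rational and the multiple of
  \<open>\<beta>\<close> lies in \<open>rational_hull L\<close>; what remains of the dual lattice is
  the condition on pairings.\<close>

lemma mem_screeners_iff:
  assumes "integral_lattice L"
  shows "\<beta> \<in> screeners L \<longleftrightarrow> \<beta> \<in> L \<and> (\<exists>k::int. \<beta> \<bullet> \<beta> = 2 * of_int k) \<and>
    (\<forall>x\<in>L. \<beta> \<noteq> 2 *\<^sub>R x) \<and> (\<forall>x\<in>L. 2 * (x \<bullet> \<beta>) / (\<beta> \<bullet> \<beta>) \<in> \<int>)"
proof -
  have "(2 / (\<beta> \<bullet> \<beta>)) *\<^sub>R \<beta> \<in> rational_hull L" if "\<beta> \<in> L"
  proof -
    have "\<beta> \<bullet> \<beta> \<in> \<rat>"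
      using integral_lattice_closed(4)[OF assms that that] Ints_subset_Rats by blast
    then have "2 / (\<beta> \<bullet> \<beta>) \<in> \<rat>" by (intro Rats_divide) auto
    with that show ?thesis by (auto simp: rational_hull_def)
  qed
  then show ?thesis
    unfolding screeners_def even_sublattice_def dual_lattice_def by auto
qed

lemma zero_notin_screeners: "integral_lattice L \<Longrightarrow> 0 \<notin> screeners L"
  using mem_screeners_iff[of L 0] by force

text \<open>For norm 2 the rescaled vector in the dual lattice condition is the root itself. Half of
  a root has norm 1/2, which is no integer, so a root is not in \<open>2L\<close>.\<close>

lemma lattice_roots_subset_screeners:
  assumes "integral_lattice L"
  shows "lattice_roots L \<subseteq> screeners L"
proof
  fix \<beta> assume "\<beta> \<in> lattice_roots L"
  then have \<beta>: "\<beta> \<in> L" "\<beta> \<bullet> \<beta> = 2" by (auto simp: lattice_roots_def)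
  have "\<beta> \<noteq> 2 *\<^sub>R x" if "x \<in> L" for x
  proof
    assume "\<beta> = 2 *\<^sub>R x"
    then have "2 * (x \<bullet> x) = 1" using \<beta> by simp
    moreover have "x \<bullet> x \<in> \<int>"
      using integral_lattice_closed(4)[OF assms that that] .
    then obtain k where "x \<bullet> x = of_int k"
      by (rule Ints_cases)
    ultimately have "of_int (2 * k) = (of_int 1 :: real)" by simp
    then have "2 * k = 1" unfolding of_int_eq_iff .
    then show False by presburger
  qed
  moreover have "\<exists>k::int. \<beta> \<bullet> \<beta> = 2 * of_int k"
    using \<beta> by (intro exI[of _ 1]) simp
  ultimately show "\<beta> \<in> screeners L"
    using \<beta> integral_lattice_closed(4)[OF assms] by (simp add: mem_screeners_iff[OF assms])
qed

lemma nonroot_screeners_Un_lattice_roots: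
  "integral_lattice L \<Longrightarrow> nonroot_screeners L \<union> lattice_roots L = screeners L"
  using lattice_roots_subset_screeners by (auto simp: nonroot_screeners_def)

section \<open>Finiteness of the set of screeners\<close>

lemma finite_lattice_ball:
  assumes L: "lattice_basis L n \<alpha>" and int: "integral_lattice L"
  shows "finite {x \<in> L. norm x \<le> C}"
proof -
  \<comment> \<open>A lattice vector is determined by its pairings with the basis, since a vector of
    \<open>L\<close> orthogonal to the basis is orthogonal to itself. The pairings are integers,
    bounded by Cauchy-Schwarz.\<close>
  let ?S = "{x \<in> L. norm x \<le> C}" and ?f = "\<lambda>x. \<lambda>i\<in>{1..n}. x \<bullet> \<alpha> i"
  have "finite {k \<in> \<int>. \<bar>k\<bar> \<le> C * norm (\<alpha> i)}" for i
    by (rule finite_abs_int_segment)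
  then have "finite (PiE {1..n} (\<lambda>i. {k \<in> \<int>. \<bar>k\<bar> \<le> C * norm (\<alpha> i)}))"
    by (intro finite_PiE) auto
  moreover have "?f ` ?S \<subseteq> PiE {1..n} (\<lambda>i. {k \<in> \<int>. \<bar>k\<bar> \<le> C * norm (\<alpha> i)})"
  proof clarify
    fix x assume x: "x \<in> L" "norm x \<le> C"
    have "\<bar>x \<bullet> \<alpha> i\<bar> \<le> C * norm (\<alpha> i)" for i
      using Cauchy_Schwarz_ineq2[of x "\<alpha> i"] mult_right_mono[OF x(2), of "norm (\<alpha> i)"] by simp
    then show "?f x \<in> PiE {1..n} (\<lambda>i. {k \<in> \<int>. \<bar>k\<bar> \<le> C * norm (\<alpha> i)})"
      using integral_lattice_closed(4)[OF int x(1) lattice_basis_mem[OF L]] by (auto intro!: restrict_PiE_iff[THEN iffD2])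
  qed
  ultimately have "finite (?f ` ?S)" by (rule rev_finite_subset)
  moreover have "inj_on ?f ?S"
  proof (rule inj_onI)
    fix x y assume xy: "x \<in> ?S" "y \<in> ?S" "?f x = ?f y"
    have "x - y = 0"
    proof (rule orthogonal_lattice_basis[OF L])
      show "x - y \<in> L" using xy integral_lattice_closed(3)[OF int] by auto
      show "(x - y) \<bullet> \<alpha> i = 0" if "i \<in> {1..n}" for i
        using fun_cong[OF xy(3), of i] that by (simp add: inner_diff_left)
    qed
    then show "x = y" by simp
  qed
  ultimately show ?thesis by (rule finite_imageD)
qed

text \<open>
  If \<open>\<beta>\<close> is a screener, then \<open>2\<beta>/\<langle>\<beta>,\<beta>\<rangle>\<close> pairs nontrivially, hence with absolute value at least
  \<open>1\<close>, with some \<open>\<alpha>\<^sub>i\<close>; by Cauchy-Schwarz the norm of \<open>\<beta>\<close> is at most twice that of \<open>\<alpha>\<^sub>i\<close>.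
\<close>

lemma finite_screeners:
  assumes "integral_lattice L"
  shows "finite (screeners L)"
proof -
  obtain n \<alpha> where L: "lattice_basis L n \<alpha>"
    using assms by (auto simp: integral_lattice_def)
  \<comment> \<open>The index \<open>i\<close> found below depends on \<open>\<beta>\<close>; the
    sum dominates all the individual bounds at once.\<close>
  let ?C = "\<Sum>i=1..n. 2 * norm (\<alpha> i)"
  have "screeners L \<subseteq> {x \<in> L. norm x \<le> ?C}"
  proof
    fix \<beta> assume "\<beta> \<in> screeners L"
    then have \<beta>: "\<beta> \<in> L" "\<And>x. x \<in> L \<Longrightarrow> 2 * (x \<bullet> \<beta>) / (\<beta> \<bullet> \<beta>) \<in> \<int>" "\<beta> \<noteq> 0"
      using zero_notin_screeners[OF assms] by (auto simp: mem_screeners_iff[OF assms])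
    then obtain i where i: "i \<in> {1..n}" "\<beta> \<bullet> \<alpha> i \<noteq> 0"
      using orthogonal_lattice_basis[OF L] by blast
    have "2 * (\<alpha> i \<bullet> \<beta>) / (\<beta> \<bullet> \<beta>) \<in> \<int>" "2 * (\<alpha> i \<bullet> \<beta>) / (\<beta> \<bullet> \<beta>) \<noteq> 0"
      using \<beta>(2)[OF lattice_basis_mem[OF L i(1)]] \<beta>(3) i(2) by (simp_all add: inner_commute)
    then have "1 \<le> \<bar>2 * (\<alpha> i \<bullet> \<beta>) / (\<beta> \<bullet> \<beta>)\<bar>"
      by (rule Ints_nonzero_abs_ge1)
    then have "\<beta> \<bullet> \<beta> \<le> 2 * \<bar>\<alpha> i \<bullet> \<beta>\<bar>"
      using \<beta>(3) by (simp add: abs_mult field_simps)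
    then have "norm \<beta> * norm \<beta> \<le> 2 * (norm (\<alpha> i) * norm \<beta>)"
      using Cauchy_Schwarz_ineq2[of "\<alpha> i" \<beta>] by (simp add: power2_norm_eq_inner flip: power2_eq_square)
    then have "norm \<beta> \<le> 2 * norm (\<alpha> i)"
      using \<beta>(3) by simp
    also have "\<dots> \<le> ?C"
      using i(1) by (intro member_le_sum) auto
    finally show "\<beta> \<in> {x \<in> L. norm x \<le> ?C}" using \<beta>(1) by simp
  qed
  then show ?thesis
    using finite_lattice_ball[OF L assms] by (rule finite_subset)
qed

text \<open>The reflection \<open>r\<close> is a self-adjoint involution, and it maps
  \<open>L\<close> to itself because its coefficients on \<open>L\<close> are integers. Hence it
  preserves the norm, membership in \<open>2L\<close> and the integrality of the pairings.\<close>

lemma reflection_screeners: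
  fixes \<alpha> \<beta> :: "'a::real_inner"
  assumes L: "integral_lattice L" and \<alpha>: "\<alpha> \<in> screeners L" and \<beta>: "\<beta> \<in> screeners L"
  shows "\<beta> - (2 * (\<beta> \<bullet> \<alpha>) / (\<alpha> \<bullet> \<alpha>)) *\<^sub>R \<alpha> \<in> screeners L"
proof -
  define r where "r x = x - (2 * (x \<bullet> \<alpha>) / (\<alpha> \<bullet> \<alpha>)) *\<^sub>R \<alpha>" for x
  have "\<alpha> \<bullet> \<alpha> \<noteq> 0" using \<alpha> zero_notin_screeners[OF L] by auto
  then have r_inner: "r x \<bullet> y = x \<bullet> r y" and r_r: "r (r x) = x" for x y
    by (simp_all add: r_def inner_diff_left inner_diff_right inner_commute algebra_simps)
  have r_scale: "r (2 *\<^sub>R x) = 2 *\<^sub>R r x" for x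
    by (simp add: r_def algebra_simps)
  have r_mem: "r x \<in> L" if "x \<in> L" for x
  proof -
    have "\<alpha> \<in> L" "2 * (x \<bullet> \<alpha>) / (\<alpha> \<bullet> \<alpha>) \<in> \<int>"
      using \<alpha> that by (auto simp: mem_screeners_iff[OF L])
    then show ?thesis
      unfolding r_def using that by (metis Ints_cases integral_lattice_closed(2,3)[OF L])
  qed
  have "r \<beta> \<bullet> r \<beta> = \<beta> \<bullet> \<beta>"
    by (simp add: r_inner r_r)
  moreover have "r \<beta> \<noteq> 2 *\<^sub>R x" if "x \<in> L" for x
  proof
    assume "r \<beta> = 2 *\<^sub>R x"
    then have "\<beta> = 2 *\<^sub>R r x" by (metis r_r r_scale)
    then show False using \<beta> r_mem[OF that] by (auto simp: mem_screeners_iff[OF L])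
  qed
  moreover have "2 * (x \<bullet> r \<beta>) / (\<beta> \<bullet> \<beta>) \<in> \<int>" if "x \<in> L" for x
    using \<beta> r_mem[OF that] by (auto simp: mem_screeners_iff[OF L] simp flip: r_inner)
  ultimately have "r \<beta> \<in> screeners L"
    using \<beta> r_mem by (simp add: mem_screeners_iff[OF L])
  then show ?thesis by (simp add: r_def)
qed

theorem root_system_screeners:
  assumes L: "integral_lattice L"
  shows "root_system (screeners L)"
  unfolding root_system_def
proof (intro conjI ballI allI impI)
  show "finite (screeners L)" "0 \<notin> screeners L"
    using finite_screeners[OF L] zero_notin_screeners[OF L] by auto
next
  fix \<alpha> \<beta> assume *: "\<alpha> \<in> screeners L" "\<beta> \<in> screeners L"
  then show "2 * (\<beta> \<bullet> \<alpha>) / (\<alpha> \<bullet> \<alpha>) \<in> \<int>"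
    by (auto simp: mem_screeners_iff[OF L])
  show "\<beta> - (2 * (\<beta> \<bullet> \<alpha>) / (\<alpha> \<bullet> \<alpha>)) *\<^sub>R \<alpha> \<in> screeners L"
    using reflection_screeners[OF L *] .
next
  fix \<alpha> and c :: real assume *: "\<alpha> \<in> screeners L" "c *\<^sub>R \<alpha> \<in> screeners L"
  have nz: "\<alpha> \<bullet> \<alpha> \<noteq> 0" "c \<noteq> 0"
    using * zero_notin_screeners[OF L] by auto
  have "2 * (c *\<^sub>R \<alpha> \<bullet> \<alpha>) / (\<alpha> \<bullet> \<alpha>) \<in> \<int>" "2 * (\<alpha> \<bullet> c *\<^sub>R \<alpha>) / (c *\<^sub>R \<alpha> \<bullet> c *\<^sub>R \<alpha>) \<in> \<int>"
    using * by (auto simp only: mem_screeners_iff[OF L])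
  then have "2 * c \<in> \<int>" "2 / c \<in> \<int>"
    using nz by simp_all
  then obtain k l :: int where kl: "2 * c = of_int k" "2 / c = of_int l"
    by (auto elim!: Ints_cases)
  \<comment> \<open>The two Cartan numbers of a proportional pair are integers with product 4, so
    \<open>2 * c\<close> is a divisor of 4.\<close>
  have "(2 * c) * (2 / c) = 4"
    using nz by simp
  then have "of_int (k * l) = (of_int 4 :: real)"
    unfolding kl by simp
  then have "k * l = 4" by (simp only: of_int_eq_iff)
  then have "k dvd 4" by (metis dvd_triv_left)
  then have "\<bar>k\<bar> \<le> 4" using dvd_imp_le_int[of 4 k] by simp
  \<comment> \<open>The values 4 and -4 of \<open>k\<close> mean \<open>c = 2\<close> and
    \<open>c = -2\<close>, which would put \<open>c *\<^sub>R \<alpha>\<close> into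
    \<open>2L\<close>. Below, 1 and -1 would in the same way put \<open>\<alpha>\<close> into
    \<open>2L\<close>.\<close>
  moreover have "k \<noteq> 4 \<and> k \<noteq> -4"
  proof -
    have "c *\<^sub>R \<alpha> \<noteq> 2 *\<^sub>R (of_int m *\<^sub>R \<alpha>)" for m
      using * integral_lattice_closed(2)[OF L] by (metis mem_screeners_iff[OF L])
    from this[of 1] this[of "-1"] show ?thesis
      using kl by (auto simp: algebra_simps)
  qed
  moreover have "k \<noteq> 1 \<and> k \<noteq> -1"
  proof -
    have "\<alpha> \<noteq> 2 *\<^sub>R (of_int m *\<^sub>R c *\<^sub>R \<alpha>)" for m
      using * integral_lattice_closed(2)[OF L] by (metis mem_screeners_iff[OF L])
    from this[of 1] this[of "-1"] show ?thesis
      using kl by auto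
  qed
  moreover have "k \<noteq> 0 \<and> k \<noteq> 3 \<and> k \<noteq> -3"
    using \<open>k dvd 4\<close> by auto
  ultimately have "k = 2 \<or> k = -2" by presburger
  then show "c = 1 \<or> c = -1" using kl by auto
qed

lemma independent_of_spanning:
  fixes \<delta> :: "nat \<Rightarrow> 'a::real_vector"
  assumes "inj_on \<alpha> {1..n}" "independent (\<alpha> ` {1..n})" "\<alpha> ` {1..n} \<subseteq> span (\<delta> ` {1..n})"
  shows "inj_on \<delta> {1..n}" "independent (\<delta> ` {1..n})"
proof -
  let ?D = "\<delta> ` {1..n}"
  have bound: "n \<le> card B" if "finite B" "\<alpha> ` {1..n} \<subseteq> span B" for B
    using independent_span_bound[OF that(1) assms(2) that(2)] assms(1) by (simp add: card_image)
  have "card ?D = n"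
    using bound[of ?D] assms(3) card_image_le[of "{1..n}" \<delta>] by simp
  then show "inj_on \<delta> {1..n}"
    by (intro eq_card_imp_inj_on) auto
  show "independent ?D"
  proof
    assume "dependent ?D"
    then obtain d where d: "d \<in> ?D" "d \<in> span (?D - {d})"
      by (auto simp: dependent_def)
    then have "span ?D = span (?D - {d})"
      by (metis insert_Diff span_redundant)
    then have "n \<le> card (?D - {d})"
      using bound[of "?D - {d}"] assms(3) by simp
    then show False
      using d(1) \<open>card ?D = n\<close> card_Diff1_less[of ?D d] by simp
  qed
qed

text \<open>Only the signs of the coefficients remain to be verified in each type: as
  \<open>R\<close> contains the lattice basis, the expansions of the \<open>\<alpha> i\<close>
  already show that the \<open>\<delta> i\<close> span it, and independence follows.\<close>

lemma simple_rootsI: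
  assumes L: "lattice_basis L n \<alpha>" and "\<alpha> ` {1..n} \<subseteq> R" and "\<delta> ` {1..n} \<subseteq> R"
    and R: "\<And>\<beta>. \<beta> \<in> R \<Longrightarrow> \<exists>c :: nat \<Rightarrow> int. \<beta> = (\<Sum>i=1..n. of_int (c i) *\<^sub>R \<delta> i) \<and>
      ((\<forall>i\<in>{1..n}. 0 \<le> c i) \<or> (\<forall>i\<in>{1..n}. c i \<le> 0))"
  shows "simple_roots R n \<delta>"
proof -
  have R': "\<exists>c :: nat \<Rightarrow> nat. \<beta> = (\<Sum>i=1..n. of_nat (c i) *\<^sub>R \<delta> i) \<or>
      \<beta> = - (\<Sum>i=1..n. of_nat (c i) *\<^sub>R \<delta> i)" if "\<beta> \<in> R" for \<beta>
  proof -
    obtain c :: "nat \<Rightarrow> int" where c: "\<beta> = (\<Sum>i=1..n. of_int (c i) *\<^sub>R \<delta> i)"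
      "(\<forall>i\<in>{1..n}. 0 \<le> c i) \<or> (\<forall>i\<in>{1..n}. c i \<le> 0)"
      using R[OF \<open>\<beta> \<in> R\<close>] by blast
    from c(2) show ?thesis
    proof
      assume "\<forall>i\<in>{1..n}. 0 \<le> c i"
      then have "\<beta> = (\<Sum>i=1..n. of_nat (nat (c i)) *\<^sub>R \<delta> i)"
        unfolding c(1) by (intro sum.cong) auto
      then show ?thesis by (intro exI[of _ "\<lambda>i. nat (c i)"]) blast
    next
      assume "\<forall>i\<in>{1..n}. c i \<le> 0"
      then have "\<beta> = - (\<Sum>i=1..n. of_nat (nat (- c i)) *\<^sub>R \<delta> i)"
        unfolding c(1) sum_negf[symmetric] by (intro sum.cong) auto
      then show ?thesis by (intro exI[of _ "\<lambda>i. nat (- c i)"]) blast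
    qed
  qed
  have "\<alpha> ` {1..n} \<subseteq> span (\<delta> ` {1..n})"
  proof clarify
    fix i assume "i \<in> {1..n}"
    then obtain c :: "nat \<Rightarrow> int" where c: "\<alpha> i = (\<Sum>i=1..n. of_int (c i) *\<^sub>R \<delta> i)"
      using R assms(2) by blast
    show "\<alpha> i \<in> span (\<delta> ` {1..n})"
      unfolding c by (intro span_sum span_scale span_base imageI)
  qed
  then have "inj_on \<delta> {1..n}" "independent (\<delta> ` {1..n})"
    using L independent_of_spanning[of \<alpha> n \<delta>] by (auto simp: lattice_basis_def)
  with assms(3) R' show ?thesis
    by (auto simp: simple_roots_def)
qed

section \<open>Orthonormal coordinates for type D\<close>

text \<open>These are the usual coordinates of D_n. The signs in \<open>\<alpha> 1\<close> give
  pairing 0 with \<open>\<alpha> 2\<close> and -1 with \<open>\<alpha> 3\<close>. The vectors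
  \<open>e i\<close> lie outside \<open>L\<close>, which contains only those integer combinations
  whose coordinate sum is even.\<close>

locale D_frame =
  fixes L :: "'a::real_inner set" and n :: nat and \<alpha> e :: "nat \<Rightarrow> 'a"
  assumes n_ge_3: "3 \<le> n" and D: "D_lattice L n \<alpha>"
    and orthonormal: "\<lbrakk>i \<in> {1..n}; j \<in> {1..n}\<rbrakk> \<Longrightarrow> e i \<bullet> e j = (if i = j then 1 else 0)"
    and \<alpha>_1: "\<alpha> 1 = - e 1 - e 2"
    and \<alpha>_Suc: "i \<in> {1..<n} \<Longrightarrow> \<alpha> (Suc i) = e i - e (Suc i)"
begin

lemma basis: "lattice_basis L n \<alpha>"
  using D n_ge_3 by (simp add: D_lattice_def)

lemma integral: "integral_lattice L"
  using D by (rule D_lattice_integral)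

definition comb :: "(nat \<Rightarrow> int) \<Rightarrow> 'a" where
  "comb x = (\<Sum>i=1..n. of_int (x i) *\<^sub>R e i)"

definition single :: "nat \<Rightarrow> int \<Rightarrow> nat \<Rightarrow> int" where
  "single i a = (\<lambda>k. if k = i then a else 0)"

lemma sum_single: "i \<in> {1..n} \<Longrightarrow> sum (single i a) {1..n} = a"
  by (simp add: single_def)

lemma comb_single: "i \<in> {1..n} \<Longrightarrow> comb (single i a) = of_int a *\<^sub>R e i"
  by (simp add: comb_def single_def if_distrib[of "\<lambda>c. of_int c *\<^sub>R _"] cong: if_cong)

lemma comb_zero: "comb (\<lambda>k. 0) = 0"
  by (simp add: comb_def)

lemma comb_add: "comb (\<lambda>k. x k + y k) = comb x + comb y"
  by (simp add: comb_def scaleR_add_left sum.distrib)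

lemma comb_scale: "comb (\<lambda>k. a * x k) = of_int a *\<^sub>R comb x"
  by (simp add: comb_def scaleR_sum_right)

lemma inner_comb: "comb x \<bullet> comb y = of_int (\<Sum>i=1..n. x i * y i)"
proof -
  have "comb x \<bullet> comb y = (\<Sum>i=1..n. \<Sum>j=1..n. of_int (x i) * of_int (y j) * (e i \<bullet> e j))"
    by (simp add: comb_def inner_sum_left inner_sum_right sum_distrib_left mult.assoc)
      (subst sum.swap, simp add: mult.left_commute)
  also have "\<dots> = (\<Sum>i=1..n. \<Sum>j=1..n. if i = j then of_int (x i) * of_int (y j) else 0)"
    by (intro sum.cong refl) (simp add: orthonormal)
  finally show ?thesis by simp
qed

lemma norm_comb: "comb x \<bullet> comb x = of_int (\<Sum>i=1..n. (x i)\<^sup>2)"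
  by (simp add: inner_comb power2_eq_square)

lemma comb_eq_iff: "comb x = comb y \<longleftrightarrow> (\<forall>i\<in>{1..n}. x i = y i)"
proof
  assume eq: "comb x = comb y"
  show "\<forall>i\<in>{1..n}. x i = y i"
  proof
    fix i assume i: "i \<in> {1..n}"
    have "(of_int (z i) :: real) = comb z \<bullet> comb (single i 1)" for z
      using i by (simp add: inner_comb single_def if_distrib[of "\<lambda>c. _ * c"] cong: if_cong)
    then have "(of_int (x i) :: real) = of_int (y i)"
      using eq by metis
    then show "x i = y i" by simp
  qed
qed (simp add: comb_def)

text \<open>Summation by parts: the coefficients on the differences are the partial sums of the
  coordinates. It is used twice, to recognize lattice vectors and to expand screeners in the base of
  type C.\<close>

lemma sum_chain:
  assumes "1 \<le> m"
  shows "(\<Sum>i=1..m. of_int (x i) *\<^sub>R e i) =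
    (\<Sum>k=1..<m. of_int (sum x {1..k}) *\<^sub>R (e k - e (Suc k))) + of_int (sum x {1..m}) *\<^sub>R e m"
  using assms
proof (induction m rule: dec_induct)
  case base
  then show ?case by simp
next
  case (step m)
  then show ?case
    by (simp add: sum.atLeastLessThan_Suc scaleR_add_left scaleR_diff_right algebra_simps)
qed

lemma comb_chain:
  "comb x = (\<Sum>k=1..<n. of_int (sum x {1..k}) *\<^sub>R (e k - e (Suc k))) + of_int (sum x {1..n}) *\<^sub>R e n"
  unfolding comb_def using n_ge_3 by (intro sum_chain) simp

text \<open>The start is \<open>2 *\<^sub>R e 1 = \<alpha> 2 - \<alpha> 1\<close>; subtracting
  \<open>2 *\<^sub>R \<alpha> (Suc m)\<close> leads from \<open>e m\<close> to the next
  vector.\<close>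

lemma two_e_mem: "i \<in> {1..n} \<Longrightarrow> 2 *\<^sub>R e i \<in> L"
proof -
  assume i: "i \<in> {1..n}"
  have mem: "\<alpha> i \<in> L" if "i \<in> {1..n}" for i
    using basis that by (rule lattice_basis_mem)
  have "1 \<le> i" using i by simp
  then have "i \<le> n \<longrightarrow> 2 *\<^sub>R e i \<in> L"
  proof (induction i rule: dec_induct)
    case base
    have "2 *\<^sub>R e 1 = \<alpha> (Suc 1) - \<alpha> 1"
      using n_ge_3 \<alpha>_Suc[of 1] \<alpha>_1 by (simp add: numeral_2_eq_2 scaleR_2)
    then show ?case
      using n_ge_3 integral_lattice_closed(3)[OF integral mem mem, of "Suc 1" 1] by simp
  next
    case (step m)
    show ?case
    proof
      assume "Suc m \<le> n"
      then have "2 *\<^sub>R e (Suc m) = 2 *\<^sub>R e m - of_int 2 *\<^sub>R \<alpha> (Suc m)"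
        using step \<alpha>_Suc[of m] by (simp add: scaleR_diff_right)
      then show "2 *\<^sub>R e (Suc m) \<in> L"
        using step \<open>Suc m \<le> n\<close> integral_lattice_closed(2,3)[OF integral] mem[of "Suc m"]
        by (metis Suc_leD atLeastAtMost_iff le_add1 plus_1_eq_Suc)
    qed
  qed
  then show ?thesis using i by simp
qed

text \<open>Each simple root has an even coordinate sum. Conversely, \<open>comb_chain\<close>
  leaves a combination of simple roots and the total times \<open>e n\<close>; an even total makes
  the latter a multiple of \<open>2 *\<^sub>R e n\<close>, which lies in \<open>L\<close>.\<close>

lemma L_eq: "L = {comb x |x. even (sum x {1..n})}"
proof (intro equalityI subsetI)
  fix v assume "v \<in> L"
  moreover have "L \<subseteq> {comb x |x. even (sum x {1..n})}"
  proof (rule lattice_basis_subset[OF basis])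
    fix i assume i: "i \<in> {1..n}"
    show "\<alpha> i \<in> {comb x |x. even (sum x {1..n})}"
    proof (cases "i = 1")
      case True
      have "comb (\<lambda>k. single 1 (-1) k + single 2 (-1) k) = \<alpha> i"
        using n_ge_3 True \<alpha>_1 by (simp add: comb_add comb_single)
      moreover have "even (\<Sum>k=1..n. single 1 (-1) k + single 2 (-1) k)"
        using n_ge_3 sum_single[of 1 "-1"] sum_single[of 2 "-1"] by (simp add: sum.distrib)
      ultimately show ?thesis by (metis (mono_tags, lifting) mem_Collect_eq)
    next
      case False
      then obtain j where j: "i = Suc j" "j \<in> {1..<n}"
        using i by (cases i) auto
      have "comb (\<lambda>k. single j 1 k + single i (-1) k) = \<alpha> i"
        using i j by (simp add: comb_add comb_single \<alpha>_Suc)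
      moreover have "even (\<Sum>k=1..n. single j 1 k + single i (-1) k)"
        using i j sum_single[of j 1] sum_single[of i "-1"] by (simp add: sum.distrib)
      ultimately show ?thesis by (metis (mono_tags, lifting) mem_Collect_eq)
    qed
  next
    show "0 \<in> {comb x |x. even (sum x {1..n})}"
      using comb_zero by (intro CollectI exI[of _ "\<lambda>k. 0"]) simp
  next
    fix v w assume "v \<in> {comb x |x. even (sum x {1..n})}" "w \<in> {comb x |x. even (sum x {1..n})}"
    then obtain x y where "v = comb x" "w = comb y" "even (sum x {1..n})" "even (sum y {1..n})"
      by blast
    then show "v + w \<in> {comb x |x. even (sum x {1..n})}"
      by (intro CollectI exI[of _ "\<lambda>k. x k + y k"]) (simp add: comb_add sum.distrib)
  next
    fix a v assume "v \<in> {comb x |x. even (sum x {1..n})}"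
    then obtain x where "v = comb x" "even (sum x {1..n})"
      by blast
    then show "of_int a *\<^sub>R v \<in> {comb x |x. even (sum x {1..n})}"
      by (intro CollectI exI[of _ "\<lambda>k. a * x k"]) (simp add: comb_scale flip: sum_distrib_left)
  qed
  ultimately show "v \<in> {comb x |x. even (sum x {1..n})}" by blast
next
  fix v assume "v \<in> {comb x |x. even (sum x {1..n})}"
  then obtain x where v: "v = comb x" and "even (sum x {1..n})" by blast
  then obtain s where s: "sum x {1..n} = s * 2" by (auto elim!: evenE)
  have top: "of_int s *\<^sub>R (2 *\<^sub>R e n) \<in> L"
    using n_ge_3 by (intro integral_lattice_closed[OF integral] two_e_mem) simp
  have chain: "(\<Sum>k\<in>I. of_int (c k) *\<^sub>R (e k - e (Suc k))) \<in> L"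
    if "finite I" "I \<subseteq> {1..<n}" for I c
    using that
  proof (induction I rule: finite_induct)
    case empty
    have "0 = of_int 0 *\<^sub>R (2 *\<^sub>R e n)" by simp
    then show ?case
      using n_ge_3 integral_lattice_closed(2)[OF integral two_e_mem] by (metis sum.empty atLeastAtMost_iff le_trans one_le_numeral order_refl)
  next
    case (insert k I)
    then have "\<alpha> (Suc k) \<in> L" by (intro lattice_basis_mem[OF basis]) simp
    then show ?case
      using insert integral_lattice_closed(1,2)[OF integral] by (simp add: \<alpha>_Suc)
  qed
  show "v \<in> L"
    unfolding v comb_chain s using top by (intro integral_lattice_closed(1)[OF integral] chain) simp_all
qed

lemma comb_mem_iff: "comb x \<in> L \<longleftrightarrow> even (sum x {1..n})"
proof
  assume "comb x \<in> L"
  then obtain y where y: "comb x = comb y" "even (sum y {1..n})"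
    by (auto simp: L_eq)
  then have "sum x {1..n} = sum y {1..n}"
    by (intro sum.cong) (auto simp: comb_eq_iff)
  with y(2) show "even (sum x {1..n})" by simp
qed (auto simp: L_eq)

end

section \<open>Construction of the orthonormal frame from the Gram matrix\<close>

lemma D_frame_exists:
  assumes "3 \<le> n" and D: "D_lattice L n \<alpha>"
  shows "\<exists>e. D_frame L n \<alpha> e"
proof -
  \<comment> \<open>The equations of the frame solved for \<open>e\<close>: the first two come from
    half the difference and half the sum of \<open>\<alpha> 1\<close> and \<open>\<alpha> 2\<close>,
    the others by subtracting simple roots. For \<open>i = 2\<close> the sum is empty.\<close>
  define e where "e i = (if i = 1 then (1/2) *\<^sub>R (\<alpha> 2 - \<alpha> 1)
    else - (1/2) *\<^sub>R (\<alpha> 1 + \<alpha> 2) - (\<Sum>k=3..i. \<alpha> k))" for i :: nat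
  have gram: "\<alpha> i \<bullet> \<alpha> j = gram_D i j" if "i \<in> {1..n}" "j \<in> {1..n}" for i j
    using D assms(1) that by (simp add: D_lattice_def)
  have chain: "(\<exists>k\<ge>3. {i, j} = {k, Suc k}) \<longleftrightarrow> i \<ge> 3 \<and> j = Suc i \<or> j \<ge> 3 \<and> i = Suc j" for i j :: nat
    by (auto simp: doubleton_eq_iff)
  have half: "(1/2) *\<^sub>R v + (1/2) *\<^sub>R v = v" for v :: 'a
    by (simp flip: scaleR_add_left)
  have e_Suc: "e (Suc i) = e i - \<alpha> (Suc i)" if "1 \<le> i" for i
  proof (cases "i = 1")
    case True
    have "\<alpha> 2 = (1/2) *\<^sub>R \<alpha> 2 + (1/2) *\<^sub>R \<alpha> 2" by (simp only: half)
    then show ?thesis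
      using True by (simp add: e_def numeral_2_eq_2 algebra_simps)
  next
    case False
    then have "3 \<le> Suc i" "i \<noteq> 1" "i \<noteq> 0" using that by auto
    then show ?thesis
      by (simp add: e_def)
  qed
  have gram_Suc: "\<alpha> (Suc m) \<bullet> \<alpha> k = (if k = 1 then (if m = 2 then -1 else 0)
      else if k = Suc m then 2 else if k = m \<or> k = Suc (Suc m) then -1 else 0)"
    if "1 \<le> m" "Suc m \<le> n" "k \<in> {1..n}" for m k
  proof -
    have "\<alpha> (Suc m) \<bullet> \<alpha> k = gram_D (Suc m) k" using that by (intro gram) auto
    then show ?thesis
      using that unfolding gram_D_def chain by (auto simp: doubleton_eq_iff)
  qed
  have pair: "i \<le> n \<longrightarrow> (\<forall>k\<in>{1..n}. e i \<bullet> \<alpha> k = (if k = 1 then (if i \<le> 2 then -1 else 0)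
      else if k = Suc i then 1 else if k = i then -1 else 0))" if "1 \<le> i" for i
    using that
  proof (induction i rule: dec_induct)
    case base
    show ?case
      using assms(1) by (auto simp: e_def inner_diff_left gram gram_D_def chain doubleton_eq_iff)
  next
    case (step m)
    show ?case
    proof (intro impI ballI)
      fix k assume k: "Suc m \<le> n" "k \<in> {1..n}"
      have "e (Suc m) \<bullet> \<alpha> k = e m \<bullet> \<alpha> k - \<alpha> (Suc m) \<bullet> \<alpha> k"
        using step by (simp add: e_Suc inner_diff_left)
      with k step show "e (Suc m) \<bullet> \<alpha> k = (if k = 1 then (if Suc m \<le> 2 then -1 else 0)
          else if k = Suc (Suc m) then 1 else if k = Suc m then -1 else 0)"
        by (simp add: gram_Suc)
    qed
  qed
  \<comment> \<open>Only the second argument is unfolded, as \<open>e m - \<alpha> (Suc m)\<close>;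
    the pairings of \<open>e i\<close> with simple roots are known from \<open>pair\<close>.\<close>
  have ortho: "j \<le> n \<longrightarrow> (\<forall>i\<in>{1..n}. e i \<bullet> e j = (if i = j then 1 else 0))" if "1 \<le> j" for j
    using that
  proof (induction j rule: dec_induct)
    case base
    have "e i \<bullet> e 1 = (if i = 1 then 1 else 0)" if "i \<in> {1..n}" for i
    proof -
      have "e i \<bullet> e 1 = (1/2) * (e i \<bullet> \<alpha> 2 - e i \<bullet> \<alpha> 1)"
        by (simp only: e_def[of 1]) (simp add: inner_diff_right)
      then show ?thesis using pair[of i] that assms(1) by (auto split: if_splits)
    qed
    then show ?case by simp
  next
    case (step m)
    show ?case
    proof (intro impI ballI)
      fix i assume i: "Suc m \<le> n" "i \<in> {1..n}"
      have "e i \<bullet> e (Suc m) = e i \<bullet> e m - e i \<bullet> \<alpha> (Suc m)"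
        using step by (simp add: e_Suc inner_diff_right)
      with i step pair[of i] show "e i \<bullet> e (Suc m) = (if i = Suc m then 1 else 0)"
        by simp
    qed
  qed
  have "D_frame L n \<alpha> e"
  proof
    show "3 \<le> n" "D_lattice L n \<alpha>" by fact+
    show "e i \<bullet> e j = (if i = j then 1 else 0)" if "i \<in> {1..n}" "j \<in> {1..n}" for i j
      using ortho[of j] that by simp
    have "\<alpha> 1 = (1/2) *\<^sub>R \<alpha> 1 + (1/2) *\<^sub>R \<alpha> 1" by (simp only: half)
    then show "\<alpha> 1 = - e 1 - e 2"
      by (simp add: e_def algebra_simps)
    show "\<alpha> (Suc i) = e i - e (Suc i)" if "i \<in> {1..<n}" for i
      using that by (simp add: e_Suc)
  qed
  then show ?thesis by blast
qed

section \<open>Norms and coordinates of the screeners of D_n\<close>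

lemma even_sum_squares_iff:
  fixes x :: "nat \<Rightarrow> int"
  assumes "finite I"
  shows "even (\<Sum>i\<in>I. (x i)\<^sup>2) \<longleftrightarrow> even (sum x I)"
  using assms by (induction I rule: finite_induct) auto

context D_frame
begin

lemma even_norm: "comb x \<in> L \<Longrightarrow> even (\<Sum>i=1..n. (x i)\<^sup>2)"
  by (simp add: comb_mem_iff even_sum_squares_iff)

text \<open>
  Since \<open>e\<^sub>i \<plusminus> e\<^sub>j\<close> lies in the lattice, the numbers \<open>y\<^sub>i = 4 x\<^sub>i / N\<close> are integers of equal parity,
  and \<open>N (\<Sum> y\<^sub>i\<^sup>2) = 16\<close>. If all \<open>y\<^sub>i\<close> are even then \<open>\<Sum> y\<^sub>i\<^sup>2\<close> is divisible by \<open>4\<close>, otherwise it is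
  at least \<open>n \<ge> 3\<close>; hence \<open>N \<le> 4\<close>, as \<open>N\<close> is even.
\<close>

lemma screener_norm:
  assumes "comb x \<in> screeners L"
  defines "N \<equiv> \<Sum>i=1..n. (x i)\<^sup>2"
  shows "N = 2 \<or> N = 4 \<and> (\<forall>i\<in>{1..n}. \<forall>j\<in>{1..n}. even (x i + x j))"
proof -
  have mem: "comb x \<in> L" and int: "\<And>v. v \<in> L \<Longrightarrow> 2 * (v \<bullet> comb x) / (comb x \<bullet> comb x) \<in> \<int>"
    using assms(1) by (auto simp: mem_screeners_iff[OF integral])
  have "comb x \<noteq> 0" using assms(1) zero_notin_screeners[OF integral] by auto
  then have "N \<noteq> 0" using norm_comb[of x] unfolding N_def[symmetric] by auto
  moreover have "N \<ge> 0" unfolding N_def by (intro sum_nonneg) simp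
  ultimately have "N > 0" by simp
  have "even N" unfolding N_def by (rule even_norm[OF mem])
  have pair: "N dvd 2 * (\<Sum>i=1..n. y i * x i)" if "even (sum y {1..n})" for y
  proof -
    have "2 * (comb y \<bullet> comb x) / (comb x \<bullet> comb x) \<in> \<int>"
      using that by (intro int) (simp add: comb_mem_iff)
    then obtain k where "2 * (comb y \<bullet> comb x) / (comb x \<bullet> comb x) = of_int k"
      by (rule Ints_cases)
    then have "2 * (of_int (\<Sum>i=1..n. y i * x i)) = (of_int k * of_int N :: real)"
      using \<open>N > 0\<close> unfolding norm_comb inner_comb N_def[symmetric] by (simp add: field_simps)
    then have "of_int (2 * (\<Sum>i=1..n. y i * x i)) = (of_int (N * k) :: real)"
      by (simp only: of_int_mult of_int_numeral mult.commute)
    then have "2 * (\<Sum>i=1..n. y i * x i) = N * k"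
      by (simp only: of_int_eq_iff)
    then show ?thesis by simp
  qed
  have single: "(\<Sum>k=1..n. single i 1 k * x k) = x i" if "i \<in> {1..n}" for i
    using that by (simp add: single_def if_distrib[of "\<lambda>c. c * _"] cong: if_cong)
  \<comment> \<open>The case \<open>i = j\<close> is included: it pairs with
    \<open>2 *\<^sub>R e i\<close> and yields that \<open>N\<close> divides \<open>4 * x i\<close>,
    which makes the quotient \<open>y i\<close> an integer.\<close>
  have dvd: "N dvd 2 * (x i + x j)" if "i \<in> {1..n}" "j \<in> {1..n}" for i j
  proof -
    have "N dvd 2 * (\<Sum>k=1..n. (single i 1 k + single j 1 k) * x k)"
      using that by (intro pair) (simp only: sum.distrib sum_single; simp)
    then show ?thesis
      using that by (simp only: distrib_right sum.distrib single)
  qed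
  have "\<exists>y. 4 * x i = N * y" if "i \<in> {1..n}" for i
    using dvd[OF that that] by (auto simp: dvd_def)
  then obtain y where y: "\<And>i. i \<in> {1..n} \<Longrightarrow> 4 * x i = N * y i" by metis
  have parity: "even (y i + y j)" if ij: "i \<in> {1..n}" "j \<in> {1..n}" for i j
  proof -
    obtain k where "2 * (x i + x j) = N * k" using dvd[OF ij] by (auto simp: dvd_def)
    then have "N * (y i + y j) = N * (2 * k)"
      using y[OF ij(1)] y[OF ij(2)] by (simp add: algebra_simps)
    then show ?thesis using \<open>N > 0\<close> by simp
  qed
  have "N * (N * (\<Sum>i=1..n. (y i)\<^sup>2)) = (\<Sum>i=1..n. (N * y i)\<^sup>2)"
    by (simp add: sum_distrib_left power2_eq_square algebra_simps)
  also have "\<dots> = (\<Sum>i=1..n. (4 * x i)\<^sup>2)"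
    by (intro sum.cong) (simp_all add: y)
  also have "\<dots> = N * 16"
    by (simp add: N_def power_mult_distrib flip: sum_distrib_left)
  finally have prod: "N * (\<Sum>i=1..n. (y i)\<^sup>2) = 16"
    using \<open>N > 0\<close> by simp
  have "N \<le> 4"
  proof (cases "even (y 1)")
    case True
    have "4 dvd (y i)\<^sup>2" if "i \<in> {1..n}" for i
    proof -
      have "even (y i)" using parity[of 1 i] that True by auto
      then show ?thesis by (auto elim!: evenE simp: power_mult_distrib)
    qed
    then have "4 dvd (\<Sum>i=1..n. (y i)\<^sup>2)" by (intro dvd_sum)
    then obtain t where "(\<Sum>i=1..n. (y i)\<^sup>2) = 4 * t" by (auto simp: dvd_def)
    then have "N * t = 4" using prod by simp
    then show ?thesis using dvd_imp_le_int[of 4 N] \<open>N > 0\<close> by (metis abs_numeral abs_of_pos dvd_triv_left zero_neq_numeral)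
  next
    case False
    have "1 \<le> (y i)\<^sup>2" if "i \<in> {1..n}" for i
    proof -
      have "y i \<noteq> 0" using parity[of 1 i] that False by auto
      then have "0 < (y i)\<^sup>2" by simp
      then show ?thesis by linarith
    qed
    then have "(\<Sum>i=1..n. 1) \<le> (\<Sum>i=1..n. (y i)\<^sup>2)" by (intro sum_mono)
    then have "3 \<le> (\<Sum>i=1..n. (y i)\<^sup>2)" using n_ge_3 by simp
    then have "N * 3 \<le> 16" using prod \<open>N > 0\<close> by (metis mult_left_mono order_less_imp_le)
    then show ?thesis using \<open>even N\<close> by presburger
  qed
  then have "N = 2 \<or> N = 4"
    using \<open>even N\<close> \<open>N > 0\<close> by presburger
  \<comment> \<open>For \<open>N = 4\<close> the quotients \<open>y i\<close> are the coordinates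
    \<open>x i\<close> themselves.\<close>
  moreover have "even (x i + x j)" if "N = 4" "i \<in> {1..n}" "j \<in> {1..n}" for i j
    using parity[of i j] y[of i] y[of j] that by simp
  ultimately show ?thesis by blast
qed

text \<open>For a vector of norm 4 the dual condition says that its pairings with \<open>L\<close>
  are even. If all \<open>x i\<close> are congruent to \<open>x 1\<close> modulo 2, the pairing with
  \<open>comb z\<close> is congruent to \<open>x 1\<close> times the even sum of \<open>z\<close>.
  Half of such a vector would have norm 1, while all norms in \<open>L\<close> are even.\<close>

lemma nonroot_screeners_eq_comb:
  "nonroot_screeners L = {comb x |x. (\<Sum>i=1..n. (x i)\<^sup>2) = 4 \<and> (\<forall>i\<in>{1..n}. \<forall>j\<in>{1..n}. even (x i + x j))}"
    (is "_ = ?R")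
proof (intro equalityI subsetI)
  fix v assume "v \<in> nonroot_screeners L"
  then have v: "v \<in> screeners L" "v \<bullet> v \<noteq> 2" "v \<in> L"
    by (auto simp: nonroot_screeners_def lattice_roots_def mem_screeners_iff[OF integral])
  then obtain x where x: "v = comb x" by (auto simp: L_eq)
  have "(\<Sum>i=1..n. (x i)\<^sup>2) \<noteq> 2"
  proof
    assume "(\<Sum>i=1..n. (x i)\<^sup>2) = 2"
    then show False using v(2) unfolding x norm_comb by simp
  qed
  then show "v \<in> ?R"
    using screener_norm[of x] v(1) x by blast
next
  fix v assume "v \<in> ?R"
  then obtain x where x: "v = comb x" "(\<Sum>i=1..n. (x i)\<^sup>2) = 4"
    and par: "\<And>i j. \<lbrakk>i \<in> {1..n}; j \<in> {1..n}\<rbrakk> \<Longrightarrow> even (x i + x j)" by blast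
  have norm: "v \<bullet> v = 4" unfolding x(1) norm_comb x(2) by simp
  have mem: "v \<in> L"
    unfolding x(1) comb_mem_iff using x(2) even_sum_squares_iff[of "{1..n}" x] by simp
  have "v \<noteq> 2 *\<^sub>R w" if w: "w \<in> L" for w
  proof
    assume eq: "v = 2 *\<^sub>R w"
    obtain z where z: "w = comb z" using w by (auto simp: L_eq)
    then have "even (\<Sum>i=1..n. (z i)\<^sup>2)" using w even_norm by blast
    moreover have "4 * (w \<bullet> w) = 4" using norm eq by simp
    then have "of_int (\<Sum>i=1..n. (z i)\<^sup>2) = (1::real)"
      unfolding z norm_comb by linarith
    then have "(\<Sum>i=1..n. (z i)\<^sup>2) = 1"
      by (simp only: of_int_eq_1_iff)
    ultimately show False by simp
  qed
  moreover have "2 * (w \<bullet> v) / (v \<bullet> v) \<in> \<int>" if w: "w \<in> L" for w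
  proof -
    obtain z where z: "w = comb z" "even (sum z {1..n})" using w by (auto simp: L_eq)
    have "(\<Sum>i=1..n. z i * x i) = (\<Sum>i=1..n. z i * (x i + x 1)) - (\<Sum>i=1..n. z i) * x 1"
      by (simp add: distrib_left sum.distrib sum_distrib_right)
    moreover have "even (\<Sum>i=1..n. z i * (x i + x 1))"
      using n_ge_3 by (intro dvd_sum dvd_mult par) auto
    ultimately have "even (\<Sum>i=1..n. z i * x i)" using z(2) by simp
    then obtain k where k: "(\<Sum>i=1..n. z i * x i) = 2 * k" by (rule evenE)
    have "2 * (w \<bullet> v) / (v \<bullet> v) = of_int k"
      unfolding norm unfolding x(1) z(1) inner_comb k by simp
    then show ?thesis by simp
  qed
  moreover have "\<exists>k::int. v \<bullet> v = 2 * of_int k"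
    using norm by (intro exI[of _ 2]) simp
  ultimately have "v \<in> screeners L"
    using mem unfolding mem_screeners_iff[OF integral] by blast
  then show "v \<in> nonroot_screeners L"
    using norm by (simp add: nonroot_screeners_def lattice_roots_def)
qed

lemma norm_nonroot_screener: "v \<in> nonroot_screeners L \<Longrightarrow> v \<bullet> v = 4"
  by (auto simp: nonroot_screeners_eq_comb norm_comb simp del: of_int_sum)

lemma root_screener: "v \<in> L \<Longrightarrow> v \<bullet> v = 2 \<Longrightarrow> v \<in> screeners L"
  using lattice_roots_subset_screeners[OF integral] by (auto simp: lattice_roots_def)

lemma basis_subset_screeners: "\<alpha> ` {1..n} \<subseteq> screeners L"
proof clarify
  fix i assume i: "i \<in> {1..n}"
  have "\<alpha> i \<bullet> \<alpha> i = 2"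
    using D i n_ge_3 by (simp add: D_lattice_def gram_D_def)
  then show "\<alpha> i \<in> screeners L"
    using lattice_basis_mem[OF basis i] by (intro root_screener)
qed

text \<open>A nonzero even coordinate already contributes at least 4, so it exhausts the
  norm.\<close>

lemma even_square_sum_4:
  fixes x :: "nat \<Rightarrow> int"
  assumes "(\<Sum>i=1..n. (x i)\<^sup>2) = 4" "\<And>i. i \<in> {1..n} \<Longrightarrow> even (x i)"
  shows "\<exists>i\<in>{1..n}. (x i = 2 \<or> x i = -2) \<and> (\<forall>j\<in>{1..n}. j \<noteq> i \<longrightarrow> x j = 0)"
proof -
  have "\<exists>i\<in>{1..n}. x i \<noteq> 0"
  proof (rule ccontr)
    assume "\<not> (\<exists>i\<in>{1..n}. x i \<noteq> 0)"
    then have "(\<Sum>i=1..n. (x i)\<^sup>2) = 0" by (intro sum.neutral) simp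
    then show False using assms(1) by simp
  qed
  then obtain i where i: "i \<in> {1..n}" "x i \<noteq> 0" by blast
  obtain a where a: "x i = 2 * a" using assms(2)[OF i(1)] by (rule evenE)
  have "0 < a\<^sup>2" using i(2) a by simp
  then have "1 \<le> a\<^sup>2" by linarith
  have "(x i)\<^sup>2 + (\<Sum>j\<in>{1..n} - {i}. (x j)\<^sup>2) = 4"
    using assms(1) i(1) by (simp add: sum.remove)
  then have split: "4 * a\<^sup>2 + (\<Sum>j\<in>{1..n} - {i}. (x j)\<^sup>2) = 4"
    by (simp add: a power_mult_distrib)
  have nonneg: "0 \<le> (\<Sum>j\<in>{1..n} - {i}. (x j)\<^sup>2)" by (intro sum_nonneg) simp
  have "a\<^sup>2 = 1" "(\<Sum>j\<in>{1..n} - {i}. (x j)\<^sup>2) = 0"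
    using split nonneg \<open>1 \<le> a\<^sup>2\<close> by linarith+
  then have "x i = 2 \<or> x i = -2" "\<forall>j\<in>{1..n} - {i}. x j = 0"
    using a by (auto simp: power2_eq_1_iff sum_nonneg_eq_0_iff)
  then show ?thesis using i(1) by blast
qed

text \<open>Each odd square is at least 1, so n is at most 4; three odd squares have an odd sum,
  which excludes n = 3.\<close>

lemma odd_square_sum_4:
  fixes x :: "nat \<Rightarrow> int"
  assumes "(\<Sum>i=1..n. (x i)\<^sup>2) = 4" "\<And>i. i \<in> {1..n} \<Longrightarrow> odd (x i)"
  shows "n = 4"
proof -
  have "1 \<le> (x i)\<^sup>2" if "i \<in> {1..n}" for i
  proof -
    have "x i \<noteq> 0" using assms(2)[OF that] by auto
    then have "0 < (x i)\<^sup>2" by simp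
    then show ?thesis by linarith
  qed
  then have "(\<Sum>i=1..n. 1) \<le> (\<Sum>i=1..n. (x i)\<^sup>2)" by (intro sum_mono)
  then have "n \<le> 4" using assms(1) by simp
  moreover have "n \<noteq> 3"
  proof
    assume "n = 3"
    \<comment> \<open>Both parities are stated together because each insertion in the induction
      switches between them.\<close>
    have "odd (card I) \<longrightarrow> odd (\<Sum>i\<in>I. (x i)\<^sup>2)" "even (card I) \<longrightarrow> even (\<Sum>i\<in>I. (x i)\<^sup>2)"
      if "finite I" "I \<subseteq> {1..n}" for I
      using that by (induction I rule: finite_induct) (auto simp: assms(2))
    from this(1)[of "{1..n}"] show False using \<open>n = 3\<close> assms(1) by simp
  qed
  ultimately show ?thesis using n_ge_3 by simp
qed

lemma two_e_nonroot_screener: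
  assumes "i \<in> {1..n}" "a = 2 \<or> a = -2"
  shows "of_int a *\<^sub>R e i \<in> nonroot_screeners L"
proof -
  have "(\<Sum>k=1..n. (single i a k)\<^sup>2) = (\<Sum>k=1..n. single i (a\<^sup>2) k)"
    by (intro sum.cong) (auto simp: single_def)
  also have "\<dots> = 4"
    using assms by (subst sum_single) auto
  finally have "(\<Sum>k=1..n. (single i a k)\<^sup>2) = 4" .
  moreover have "even (single i a k)" for k
    using assms(2) by (auto simp: single_def)
  ultimately show ?thesis
    using assms(1) unfolding nonroot_screeners_eq_comb
    by (intro CollectI exI[of _ "single i a"]) (simp add: comb_single)
qed

lemma comb_eq_single:
  assumes "i \<in> {1..n}" "\<And>j. j \<in> {1..n} \<Longrightarrow> j \<noteq> i \<Longrightarrow> x j = 0"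
  shows "comb x = of_int (x i) *\<^sub>R e i"
  using assms unfolding comb_single[OF assms(1), symmetric] comb_eq_iff by (simp add: single_def)

lemma nonroot_screeners_eq_axes:
  assumes "n \<noteq> 4"
  shows "nonroot_screeners L = (\<Union>i\<in>{1..n}. {2 *\<^sub>R e i, - (2 *\<^sub>R e i)})"
proof (intro equalityI subsetI)
  fix v assume "v \<in> nonroot_screeners L"
  then obtain x where x: "v = comb x" "(\<Sum>i=1..n. (x i)\<^sup>2) = 4"
    and par: "\<And>i j. \<lbrakk>i \<in> {1..n}; j \<in> {1..n}\<rbrakk> \<Longrightarrow> even (x i + x j)"
    unfolding nonroot_screeners_eq_comb by blast
  have "even (x i)" if i: "i \<in> {1..n}" for i
  proof (rule ccontr)
    assume "odd (x i)"
    then have "odd (x j)" if "j \<in> {1..n}" for j using par[OF i that] by simp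
    then show False using odd_square_sum_4[OF x(2)] assms by blast
  qed
  then obtain i where i: "i \<in> {1..n}" "x i = 2 \<or> x i = -2" "\<And>j. j \<in> {1..n} \<Longrightarrow> j \<noteq> i \<Longrightarrow> x j = 0"
    using even_square_sum_4[OF x(2)] by blast
  then have "v = of_int (x i) *\<^sub>R e i"
    unfolding x(1) by (intro comb_eq_single)
  then show "v \<in> (\<Union>i\<in>{1..n}. {2 *\<^sub>R e i, - (2 *\<^sub>R e i)})"
    using i(1,2) by auto
next
  fix v assume "v \<in> (\<Union>i\<in>{1..n}. {2 *\<^sub>R e i, - (2 *\<^sub>R e i)})"
  then show "v \<in> nonroot_screeners L"
    using two_e_nonroot_screener[of _ 2] two_e_nonroot_screener[of _ "-2"] by auto
qed

lemma card_axes: "card (\<Union>i\<in>{1..n}. {2 *\<^sub>R e i, - (2 *\<^sub>R e i)}) = 2 * n"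
proof -
  let ?f = "\<lambda>(i, a). of_int a *\<^sub>R e i" and ?S = "{1..n} \<times> {2, -2 :: int}"
  have "inj_on ?f ?S"
  proof (rule inj_onI, clarify)
    fix i a j b assume ij: "i \<in> {1..n}" "j \<in> {1..n}" and ab: "a \<in> {2, -2}" "b \<in> {2, -2 :: int}"
      and eq: "of_int a *\<^sub>R e i = (of_int b *\<^sub>R e j :: 'a)"
    have "of_int a *\<^sub>R e i \<bullet> e i = of_int b *\<^sub>R e j \<bullet> e i"
      using eq by simp
    then have "of_int a = (if j = i then of_int b else 0 :: real)"
      using ij by (simp add: orthonormal)
    then show "i = j \<and> a = b" using ab by (auto split: if_splits)
  qed
  then have "card (?f ` ?S) = 2 * n"
    by (simp add: card_image card_cartesian_product)
  moreover have "?f ` ?S = (\<Union>i\<in>{1..n}. {2 *\<^sub>R e i, - (2 *\<^sub>R e i)})"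
    by force
  ultimately show ?thesis by simp
qed

end

section \<open>Type C\<close>

text \<open>The two blocks of coordinates, up to \<open>k\<close> and from \<open>Suc k\<close> to
  \<open>l\<close>, are disjoint, and an integer is bounded in absolute value by its square.\<close>

lemma abs_partial_sums_le:
  fixes x :: "nat \<Rightarrow> int"
  assumes "k \<le> l" "l \<le> n"
  shows "\<bar>sum x {1..k}\<bar> + \<bar>sum x {1..l} - sum x {1..k}\<bar> \<le> (\<Sum>i=1..n. (x i)\<^sup>2)"
proof -
  have abs_le_sq: "\<bar>z\<bar> \<le> z\<^sup>2" for z :: int
    using self_le_power[of "\<bar>z\<bar>" 2] by (cases "z = 0") auto
  have le: "\<bar>sum x I\<bar> \<le> (\<Sum>i\<in>I. (x i)\<^sup>2)" for I
    by (rule order_trans[OF sum_abs sum_mono]) (rule abs_le_sq)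
  have un: "{1..l} = {1..k} \<union> {Suc k..l}" "{1..k} \<inter> {Suc k..l} = {}"
    using assms(1) by auto
  have "sum x {1..l} - sum x {1..k} = sum x {Suc k..l}"
    unfolding un(1) by (subst sum.union_disjoint) auto
  then have "\<bar>sum x {1..k}\<bar> + \<bar>sum x {1..l} - sum x {1..k}\<bar>
      \<le> (\<Sum>i\<in>{1..k}. (x i)\<^sup>2) + (\<Sum>i\<in>{Suc k..l}. (x i)\<^sup>2)"
    by (simp only:) (intro add_mono le)
  also have "\<dots> = (\<Sum>i=1..l. (x i)\<^sup>2)"
    unfolding un(1) by (subst sum.union_disjoint) auto
  also have "\<dots> \<le> (\<Sum>i=1..n. (x i)\<^sup>2)"
    using assms(2) by (intro sum_mono2) auto
  finally show ?thesis .
qed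

text \<open>Passing between partial sums of opposite strict signs costs at least 1 to reach the
  first and at least 2 to cross to the other, which exceeds the bound 2.\<close>

lemma partial_sums_same_sign:
  fixes x :: "nat \<Rightarrow> int"
  assumes "(\<Sum>i=1..n. (x i)\<^sup>2) \<le> 2"
  shows "(\<forall>k\<in>{1..n}. 0 \<le> sum x {1..k}) \<or> (\<forall>k\<in>{1..n}. sum x {1..k} \<le> 0)"
proof (rule ccontr)
  assume "\<not> ?thesis"
  then obtain k l where kl: "k \<le> n" "l \<le> n" "sum x {1..k} < 0" "0 < sum x {1..l}"
    by (auto simp: not_le)
  show False
  proof (cases "k \<le> l")
    case True
    then show ?thesis using abs_partial_sums_le[of k l n x] kl assms by linarith
  next
    case False
    then show ?thesis using abs_partial_sums_le[of l k n x] kl assms by linarith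
  qed
qed

context D_frame
begin

text \<open>Roots have norm 2 and fall under \<open>partial_sums_same_sign\<close>. The remaining
  screeners have norm 4 but a single nonzero coordinate, so their partial sums are 0 and then
  constantly 2 or -2.\<close>

lemma C_simple_root_coefficients:
  assumes "n \<noteq> 4" "v \<in> screeners L"
  shows "\<exists>x. v = comb x \<and> even (sum x {1..n}) \<and>
    ((\<forall>k\<in>{1..n}. 0 \<le> sum x {1..k}) \<or> (\<forall>k\<in>{1..n}. sum x {1..k} \<le> 0))"
proof (cases "v \<in> nonroot_screeners L")
  case True
  then obtain i where i: "i \<in> {1..n}" "v = 2 *\<^sub>R e i \<or> v = - (2 *\<^sub>R e i)"
    unfolding nonroot_screeners_eq_axes[OF assms(1)] by blast
  then obtain a where a: "v = of_int a *\<^sub>R e i" "a = 2 \<or> a = -2"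
    by (metis of_int_minus of_int_numeral scaleR_minus_left)
  have "sum (single i a) {1..k} = (if i \<le> k then a else 0)" for k
    using i(1) by (simp add: single_def)
  moreover have "v = comb (single i a)" using comb_single[OF i(1)] a(1) by simp
  ultimately show ?thesis
    using a(2) by (intro exI[of _ "single i a"]) auto
next
  case False
  then have "v \<in> L" "v \<bullet> v = 2"
    using assms(2) by (auto simp: nonroot_screeners_def lattice_roots_def)
  then obtain x where x: "v = comb x" "even (sum x {1..n})" by (auto simp: L_eq)
  have "(of_int (\<Sum>i=1..n. (x i)\<^sup>2) :: real) = of_int 2"
    using \<open>v \<bullet> v = 2\<close> unfolding x(1) norm_comb by simp
  then have "(\<Sum>i=1..n. (x i)\<^sup>2) = 2" by (simp only: of_int_eq_iff)
  then show ?thesis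
    using x partial_sums_same_sign[of x n] by auto
qed

lemma screeners_type_C:
  assumes "n \<noteq> 4"
  shows "root_system_of_type (screeners L) n (cartan_C n)"
proof -
  \<comment> \<open>The chain \<open>\<alpha> 2\<close>, ..., \<open>\<alpha> n\<close> of short
    roots, closed by the long root \<open>2 *\<^sub>R e n\<close>.\<close>
  define \<delta> where "\<delta> k = (if k = n then 2 *\<^sub>R e n else e k - e (Suc k))" for k
  have "simple_roots (screeners L) n \<delta>"
  proof (rule simple_rootsI[OF basis basis_subset_screeners])
    show "\<delta> ` {1..n} \<subseteq> screeners L"
    proof clarify
      fix k assume k: "k \<in> {1..n}"
      show "\<delta> k \<in> screeners L"
      proof (cases "k = n")
        case True
        then show ?thesis
          using two_e_nonroot_screener[of n 2] k by (simp add: \<delta>_def nonroot_screeners_def)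
      next
        case False
        then have "\<delta> k = \<alpha> (Suc k)" "Suc k \<in> {1..n}"
          using k \<alpha>_Suc[of k] by (auto simp: \<delta>_def)
        then show ?thesis using basis_subset_screeners by auto
      qed
    qed
  next
    fix v assume "v \<in> screeners L"
    then obtain x where x: "v = comb x" "even (sum x {1..n})"
      "(\<forall>k\<in>{1..n}. 0 \<le> sum x {1..k}) \<or> (\<forall>k\<in>{1..n}. sum x {1..k} \<le> 0)"
      using C_simple_root_coefficients[OF assms] by blast
    obtain s where s: "sum x {1..n} = 2 * s" using x(2) by (rule evenE)
    \<comment> \<open>The last coefficient is half the total, since the last base vector is
      \<open>2 *\<^sub>R e n\<close> and not \<open>e n\<close>.\<close>
    define c where "c k = (if k = n then s else sum x {1..k})" for k
    have "{1..n} = insert n {1..<n}" using n_ge_3 by auto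
    then have "(\<Sum>k=1..n. of_int (c k) *\<^sub>R \<delta> k) = of_int s *\<^sub>R 2 *\<^sub>R e n +
        (\<Sum>k=1..<n. of_int (c k) *\<^sub>R \<delta> k)"
      by (simp add: c_def \<delta>_def)
    also have "(\<Sum>k=1..<n. of_int (c k) *\<^sub>R \<delta> k) =
        (\<Sum>k=1..<n. of_int (sum x {1..k}) *\<^sub>R (e k - e (Suc k)))"
      by (intro sum.cong) (auto simp: c_def \<delta>_def)
    also have "of_int s *\<^sub>R 2 *\<^sub>R e n + \<dots> = v"
      unfolding x(1) comb_chain s by (simp add: mult.commute)
    finally have "v = (\<Sum>k=1..n. of_int (c k) *\<^sub>R \<delta> k)" by simp
    moreover have "0 \<le> s \<longleftrightarrow> 0 \<le> sum x {1..n}" "s \<le> 0 \<longleftrightarrow> sum x {1..n} \<le> 0"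
      unfolding s by auto
    ultimately show "\<exists>c :: nat \<Rightarrow> int. v = (\<Sum>i=1..n. of_int (c i) *\<^sub>R \<delta> i) \<and>
        ((\<forall>i\<in>{1..n}. 0 \<le> c i) \<or> (\<forall>i\<in>{1..n}. c i \<le> 0))"
      using x(3) by (intro exI[of _ c]) (auto simp: c_def)
  qed
  moreover have "2 * (\<delta> i \<bullet> \<delta> j) / (\<delta> j \<bullet> \<delta> j) = of_int (cartan_C n i j)"
    if ij: "i \<in> {1..n}" "j \<in> {1..n}" for i j
  proof -
    have n: "n \<in> {1..n}" using n_ge_3 by simp
    consider "i = n" "j = n" | "i = n" "Suc j \<in> {1..n}" "j \<noteq> n" | "Suc i \<in> {1..n}" "i \<noteq> n" "j = n"
      | "Suc i \<in> {1..n}" "i \<noteq> n" "Suc j \<in> {1..n}" "j \<noteq> n"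
      using ij by fastforce
    then show ?thesis
    proof cases
      case 1
      then show ?thesis using n by (simp add: \<delta>_def cartan_C_def orthonormal)
    next
      case 2
      then have "\<delta> i \<bullet> \<delta> j = (if Suc j = n then -2 else 0)" "\<delta> j \<bullet> \<delta> j = 2"
        using n ij by (auto simp: \<delta>_def orthonormal inner_diff_left inner_diff_right)
      then show ?thesis using 2 by (simp add: cartan_C_def)
    next
      case 3
      then have "\<delta> i \<bullet> \<delta> j = (if Suc i = n then -2 else 0)" "\<delta> j \<bullet> \<delta> j = 4"
        using n ij by (auto simp: \<delta>_def orthonormal inner_diff_left inner_diff_right)
      then show ?thesis using 3 by (simp add: cartan_C_def)
    next
      case 4
      then have "\<delta> i \<bullet> \<delta> j = (if i = j then 2 else if j = Suc i \<or> i = Suc j then -1 else 0)"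
          "\<delta> j \<bullet> \<delta> j = 2"
        using n ij by (auto simp: \<delta>_def orthonormal inner_diff_left inner_diff_right)
      then show ?thesis using 4 by (simp add: cartan_C_def)
    qed
  qed
  ultimately show ?thesis
    unfolding root_system_of_type_def using root_system_screeners[OF integral] by blast
qed

text \<open>The sum of \<open>\<alpha> 3\<close> to \<open>\<alpha> j\<close> telescopes to
  \<open>e 2 - e j\<close>, so the listed vectors are the negatives of the doubled frame
  vectors.\<close>

lemma axes_eq:
  shows "\<alpha> 1 + \<alpha> 2 = - (2 *\<^sub>R e 2)" "\<alpha> 1 - \<alpha> 2 = - (2 *\<^sub>R e 1)"
    and "j \<in> {3..n} \<Longrightarrow> \<alpha> 1 + \<alpha> 2 + 2 *\<^sub>R (\<Sum>i=3..j. \<alpha> i) = - (2 *\<^sub>R e j)"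
proof -
  have \<alpha>2: "\<alpha> 2 = e 1 - e 2"
    using \<alpha>_Suc[of 1] n_ge_3 by (simp add: numeral_2_eq_2)
  show 12: "\<alpha> 1 + \<alpha> 2 = - (2 *\<^sub>R e 2)" "\<alpha> 1 - \<alpha> 2 = - (2 *\<^sub>R e 1)"
    unfolding \<alpha>_1 \<alpha>2 by (simp_all add: scaleR_2)
  have "(\<Sum>i=3..j. \<alpha> i) = e 2 - e j" if "j \<in> {3..n}"
  proof -
    have "(\<Sum>i=3..j. \<alpha> i) = (\<Sum>i=3..j. e (i - 1) - e i)"
    proof (rule sum.cong)
      fix i assume "i \<in> {3..j}"
      then show "\<alpha> i = e (i - 1) - e i" using \<alpha>_Suc[of "i - 1"] that by (cases i) auto
    qed simp
    also have "\<dots> = - (\<Sum>i=Suc 2..j. e i - e (i - 1))"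
      by (simp flip: sum_negf)
    also have "\<dots> = e 2 - e j"
      using that by (subst sum_telescope'') auto
    finally show ?thesis .
  qed
  then show "j \<in> {3..n} \<Longrightarrow> \<alpha> 1 + \<alpha> 2 + 2 *\<^sub>R (\<Sum>i=3..j. \<alpha> i) = - (2 *\<^sub>R e j)"
    using 12(1) by (simp add: scaleR_diff_right)
qed

lemma axes_in_basis:
  "(\<Union>i\<in>{1..n}. {2 *\<^sub>R e i, - (2 *\<^sub>R e i)}) =
    {\<alpha> 1 + \<alpha> 2, - (\<alpha> 1 + \<alpha> 2), \<alpha> 1 - \<alpha> 2, - (\<alpha> 1 - \<alpha> 2)} \<union>
    (\<Union>j\<in>{3..n}. {\<alpha> 1 + \<alpha> 2 + 2 *\<^sub>R (\<Sum>i=3..j. \<alpha> i),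
       - (\<alpha> 1 + \<alpha> 2 + 2 *\<^sub>R (\<Sum>i=3..j. \<alpha> i))})"
proof -
  have "{1..n} = {1, 2} \<union> {3..n}" using n_ge_3 by auto
  moreover have "(\<Union>j\<in>{3..n}. {\<alpha> 1 + \<alpha> 2 + 2 *\<^sub>R (\<Sum>i=3..j. \<alpha> i),
       - (\<alpha> 1 + \<alpha> 2 + 2 *\<^sub>R (\<Sum>i=3..j. \<alpha> i))}) = (\<Union>i\<in>{3..n}. {2 *\<^sub>R e i, - (2 *\<^sub>R e i)})"
    by (intro SUP_cong refl) (simp only: axes_eq(3) minus_minus insert_commute)
  ultimately show ?thesis
    unfolding axes_eq(1,2) by auto
qed

end

section \<open>Type F\<close>

lemma square_le_4_cases: "z\<^sup>2 \<le> 4 \<Longrightarrow> z \<in> {-2, -1, 0, 1, 2 :: int}"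
  using abs_le_square_iff[of z 2] by auto

lemma four_squares_le_4:
  fixes a b c d :: int
  assumes "a\<^sup>2 + b\<^sup>2 + c\<^sup>2 + d\<^sup>2 \<le> 4"
  shows "a \<in> {-2, -1, 0, 1, 2}" "b \<in> {-2, -1, 0, 1, 2}" "c \<in> {-2, -1, 0, 1, 2}" "d \<in> {-2, -1, 0, 1, 2}"
  using assms zero_le_power2[of a] zero_le_power2[of b] zero_le_power2[of c] zero_le_power2[of d]
  by (intro square_le_4_cases; linarith)+

lemma sum_four_squares_eq_4_same_parity:
  "{(a, b, c, d). a\<^sup>2 + b\<^sup>2 + c\<^sup>2 + d\<^sup>2 = (4 :: int) \<and> even (a + b) \<and> even (a + c) \<and> even (a + d)} =
    {(2, 0, 0, 0), (0, 2, 0, 0), (0, 0, 2, 0), (0, 0, 0, 2),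
     (-2, 0, 0, 0), (0, -2, 0, 0), (0, 0, -2, 0), (0, 0, 0, -2),
     (1, 1, 1, 1), (1, 1, 1, -1), (1, 1, -1, 1), (1, 1, -1, -1),
     (1, -1, 1, 1), (1, -1, 1, -1), (1, -1, -1, 1), (1, -1, -1, -1),
     (-1, 1, 1, 1), (-1, 1, 1, -1), (-1, 1, -1, 1), (-1, 1, -1, -1),
     (-1, -1, 1, 1), (-1, -1, 1, -1), (-1, -1, -1, 1), (-1, -1, -1, -1)}" (is "?S = ?T")
proof
  \<comment> \<open>The 625 candidate quadruples are decided by evaluation. Squares are written as
    products here and translated by \<open>power2_eq_square\<close>.\<close>
  have all: "\<forall>a\<in>{-2, -1, 0, 1, 2}. \<forall>b\<in>{-2, -1, 0, 1, 2}. \<forall>c\<in>{-2, -1, 0, 1, 2}. \<forall>d\<in>{-2, -1, 0, 1, 2}.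
      a * a + b * b + c * c + d * d = 4 \<and> even (a + b) \<and> even (a + c) \<and> even (a + d) \<longrightarrow> (a, b, c, d) \<in> ?T"
    by code_simp
  show "?S \<subseteq> ?T"
  proof
    fix t assume "t \<in> ?S"
    then obtain a b c d where t: "t = (a, b, c, d)"
      and eq: "a\<^sup>2 + b\<^sup>2 + c\<^sup>2 + d\<^sup>2 = 4" "even (a + b)" "even (a + c)" "even (a + d)"
      by blast
    then have "a\<^sup>2 + b\<^sup>2 + c\<^sup>2 + d\<^sup>2 \<le> 4" by simp
    then show "t \<in> ?T"
      unfolding t by (intro all[rule_format] four_squares_le_4[of a b c d])
        (use eq in \<open>simp_all add: power2_eq_square\<close>)
  qed
  show "?T \<subseteq> ?S" by simp
qed

text \<open>Integer tuples turn identities between lattice vectors into statements that can be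
  evaluated. The last branch is the row of \<open>\<alpha> 4\<close>.\<close>

definition D4_coords :: "nat \<Rightarrow> int \<times> int \<times> int \<times> int" where
  "D4_coords i = (if i = 1 then (-1, -1, 0, 0) else if i = 2 then (1, -1, 0, 0)
    else if i = 3 then (0, 1, -1, 0) else (0, 0, 1, -1))"

text \<open>
  The seven vectors attached to a triple in part (iii), where \<open>p\<close>, \<open>q\<close>, \<open>r\<close> are the coordinates of
  \<open>\<alpha>\<^sub>i\<close>, \<open>\<alpha>\<^sub>j\<close>, \<open>\<alpha>\<^sub>k\<close>.
\<close>

definition D4_nonroots ::
    "int \<times> int \<times> int \<times> int \<Rightarrow> int \<times> int \<times> int \<times> int \<Rightarrow> int \<times> int \<times> int \<times> int \<Rightarrow>
     (int \<times> int \<times> int \<times> int) set" where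
  "D4_nonroots p q r = (let c = D4_coords 3 + D4_coords 3 in
    {p + q, - (p + q), p - q, p + p + q + c + r, - (p + p + q + c + r), p + c + q, - (p + c + q)})"

text \<open>The six orderings of the outer nodes 1, 2, 4 produce 42 vectors with many repetitions;
  evaluation confirms that 24 different ones remain.\<close>

lemma D4_nonroots_Union:
  "(\<Union>(i, j, k) \<in> {(1, 2, 4), (1, 4, 2), (2, 1, 4), (2, 4, 1), (4, 1, 2), (4, 2, 1)}.
     D4_nonroots (D4_coords i) (D4_coords j) (D4_coords k)) =
   {(a, b, c, d). a\<^sup>2 + b\<^sup>2 + c\<^sup>2 + d\<^sup>2 = 4 \<and> even (a + b) \<and> even (a + c) \<and> even (a + d)}"
  unfolding sum_four_squares_eq_4_same_parity by code_simp

text \<open>The numbers \<open>a\<close>, \<open>k\<close>, \<open>2 * a - c - d\<close>,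
  \<open>a - d\<close> are the coefficients of the vector (a, b, c, d) in the base used for F_4. The
  second is half of \<open>3 * a - b - c - d\<close>, so the finite check uses its double and stays
  free of \<open>k\<close>.\<close>

lemma F4_coefficients_same_sign:
  fixes a b c d k :: int
  assumes N: "a\<^sup>2 + b\<^sup>2 + c\<^sup>2 + d\<^sup>2 = 2 \<or>
      a\<^sup>2 + b\<^sup>2 + c\<^sup>2 + d\<^sup>2 = 4 \<and> even (a + b) \<and> even (a + c) \<and> even (a + d)"
    and k: "3 * a - b - c - d = 2 * k"
  shows "0 \<le> a \<and> 0 \<le> k \<and> 0 \<le> 2 * a - c - d \<and> 0 \<le> a - d \<or>
    a \<le> 0 \<and> k \<le> 0 \<and> 2 * a - c - d \<le> 0 \<and> a - d \<le> 0"
proof -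
  have all: "\<forall>a\<in>{-2, -1, 0, 1, 2::int}. \<forall>b\<in>{-2, -1, 0, 1, 2}. \<forall>c\<in>{-2, -1, 0, 1, 2}. \<forall>d\<in>{-2, -1, 0, 1, 2}.
      a * a + b * b + c * c + d * d = 2 \<or>
      a * a + b * b + c * c + d * d = 4 \<and> even (a + b) \<and> even (a + c) \<and> even (a + d) \<longrightarrow>
      0 \<le> a \<and> 0 \<le> 3 * a - b - c - d \<and> 0 \<le> 2 * a - c - d \<and> 0 \<le> a - d \<or>
      a \<le> 0 \<and> 3 * a - b - c - d \<le> 0 \<and> 2 * a - c - d \<le> 0 \<and> a - d \<le> 0"
    by code_simp
  have "a\<^sup>2 + b\<^sup>2 + c\<^sup>2 + d\<^sup>2 \<le> 4" using N by auto
  from all[rule_format, OF four_squares_le_4[OF this]] N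
  have "0 \<le> a \<and> 0 \<le> 3 * a - b - c - d \<and> 0 \<le> 2 * a - c - d \<and> 0 \<le> a - d \<or>
      a \<le> 0 \<and> 3 * a - b - c - d \<le> 0 \<and> 2 * a - c - d \<le> 0 \<and> a - d \<le> 0"
    unfolding power2_eq_square by argo
  then show ?thesis unfolding k by simp
qed

context D_frame
begin

definition quad :: "int \<times> int \<times> int \<times> int \<Rightarrow> 'a" where
  "quad = (\<lambda>(a, b, c, d). of_int a *\<^sub>R e 1 + of_int b *\<^sub>R e 2 + of_int c *\<^sub>R e 3 + of_int d *\<^sub>R e 4)"

lemma quad_arith:
  "quad (a, b, c, d) + quad (a', b', c', d') = quad (a + a', b + b', c + c', d + d')"
  "of_int m *\<^sub>R quad (a, b, c, d) = quad (m * a, m * b, m * c, m * d)"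
  by (simp_all add: quad_def algebra_simps)

lemma quad_add: "quad (s + t) = quad s + quad t"
  and quad_diff: "quad (s - t) = quad s - quad t"
  and quad_minus: "quad (- t) = - quad t"
  by (cases s; cases t; simp add: quad_def algebra_simps)+

context
  assumes n_eq_4: "n = 4"
begin

lemma four: "{1..n} = {1, 2, 3, 4}"
  using n_eq_4 by auto

lemma comb_eq_quad: "comb x = quad (x 1, x 2, x 3, x 4)"
  unfolding comb_def four by (simp add: quad_def)

lemma quad_eq_iff: "quad s = quad t \<longleftrightarrow> s = t"
proof -
  have "\<exists>x :: nat \<Rightarrow> int. x 1 = a \<and> x 2 = b \<and> x 3 = c \<and> x 4 = d" for a b c d
    by (intro exI[of _ "(\<lambda>_. 0)(1 := a, 2 := b, 3 := c, 4 := d)"]) simp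
  then obtain f g :: "nat \<Rightarrow> int" where fg: "s = (f 1, f 2, f 3, f 4)" "t = (g 1, g 2, g 3, g 4)"
    by (metis prod_cases4)
  show ?thesis
    using comb_eq_iff[of f g] unfolding fg comb_eq_quad four by simp
qed

lemma basis_eq_quad:
  "\<alpha> 1 = quad (-1, -1, 0, 0)" "\<alpha> 2 = quad (1, -1, 0, 0)"
  "\<alpha> 3 = quad (0, 1, -1, 0)" "\<alpha> 4 = quad (0, 0, 1, -1)"
  using \<alpha>_1 \<alpha>_Suc[of 1] \<alpha>_Suc[of 2] \<alpha>_Suc[of 3] n_eq_4 by (simp_all add: quad_def eval_nat_numeral)

lemma nonroot_screeners_eq_quad:
  "nonroot_screeners L = quad ` {(a, b, c, d).
    a\<^sup>2 + b\<^sup>2 + c\<^sup>2 + d\<^sup>2 = 4 \<and> even (a + b) \<and> even (a + c) \<and> even (a + d)}" (is "_ = quad ` ?S")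
proof (intro equalityI subsetI)
  fix v assume "v \<in> nonroot_screeners L"
  then obtain x where x: "v = comb x" "(\<Sum>i=1..n. (x i)\<^sup>2) = 4"
      and par: "\<And>i j. \<lbrakk>i \<in> {1..n}; j \<in> {1..n}\<rbrakk> \<Longrightarrow> even (x i + x j)"
    unfolding nonroot_screeners_eq_comb by blast
  have "even (x 1 + x 2)" "even (x 1 + x 3)" "even (x 1 + x 4)"
    unfolding four by (intro par; simp add: n_eq_4)+
  then have "(x 1, x 2, x 3, x 4) \<in> ?S"
    using x(2) unfolding four by (simp add: add.assoc)
  then show "v \<in> quad ` ?S"
    unfolding x(1) comb_eq_quad by (rule imageI)
next
  fix v assume "v \<in> quad ` ?S"
  then obtain a b c d where v: "v = quad (a, b, c, d)" "a\<^sup>2 + b\<^sup>2 + c\<^sup>2 + d\<^sup>2 = 4"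
      "even (a + b)" "even (a + c)" "even (a + d)"
    by blast
  define x where "x = (\<lambda>_::nat. 0::int)(1 := a, 2 := b, 3 := c, 4 := d)"
  have x: "x 1 = a" "x 2 = b" "x 3 = c" "x 4 = d" by (simp_all add: x_def)
  have "\<forall>i\<in>{1, 2, 3, 4}. \<forall>j\<in>{1, 2, 3, 4}. even (x i + x j)"
    using v(3-) x by (simp add: x_def)
  moreover have "v = quad (x 1, x 2, x 3, x 4)" "(\<Sum>i\<in>{1, 2, 3, 4}. (x i)\<^sup>2) = 4"
    using v(1,2) x by (simp_all add: add.assoc)
  ultimately show "v \<in> nonroot_screeners L"
    unfolding nonroot_screeners_eq_comb comb_eq_quad four by blast
qed

text \<open>The additive map \<open>quad\<close> sends \<open>D4_coords i\<close> to
  \<open>\<alpha> i\<close>, so both sides are images of sets of integer quadruples, compared in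
  \<open>D4_nonroots_Union\<close>.\<close>

lemma nonroot_screeners_D4:
  "nonroot_screeners L =
    (\<Union>(i, j, k) \<in> {(i, j, k). {i, j, k} = {1, 2, 4}}.
       {\<alpha> i + \<alpha> j, - (\<alpha> i + \<alpha> j), \<alpha> i - \<alpha> j,
        2 *\<^sub>R \<alpha> i + \<alpha> j + 2 *\<^sub>R \<alpha> 3 + \<alpha> k, - (2 *\<^sub>R \<alpha> i + \<alpha> j + 2 *\<^sub>R \<alpha> 3 + \<alpha> k),
        \<alpha> i + 2 *\<^sub>R \<alpha> 3 + \<alpha> j, - (\<alpha> i + 2 *\<^sub>R \<alpha> 3 + \<alpha> j)})" (is "_ = ?R")
proof -
  have perm: "(i, j, k) \<in> {(1, 2, 4), (1, 4, 2), (2, 1, 4), (2, 4, 1), (4, 1, 2), (4, 2, 1)}"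
    if eq: "{i, j, k} = {1, 2, 4}" for i j k :: nat
  proof -
    have "1 \<in> {i, j, k}" "2 \<in> {i, j, k}" "4 \<in> {i, j, k}" unfolding eq by simp_all
    then show ?thesis by (elim insertE emptyE) simp_all
  qed
  have perms: "{(i, j, k). {i, j, k} = {1, 2, 4 :: nat}} =
      {(1, 2, 4), (1, 4, 2), (2, 1, 4), (2, 4, 1), (4, 1, 2), (4, 2, 1)}"
  proof (intro equalityI subsetI)
    fix t assume "t \<in> {(i, j, k). {i, j, k} = {1, 2, 4 :: nat}}"
    then obtain i j k where t: "t = (i, j, k)" "{i, j, k} = {1, 2, 4}" by blast
    show "t \<in> {(1, 2, 4), (1, 4, 2), (2, 1, 4), (2, 4, 1), (4, 1, 2), (4, 2, 1)}"
      unfolding t(1) by (rule perm[OF t(2)])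
  qed (auto simp: insert_commute)
  have basis: "\<alpha> i = quad (D4_coords i)" if "i \<in> {1, 2, 3, 4}" for i
    using that by (elim insertE emptyE; simp only: basis_eq_quad; simp add: D4_coords_def)
  have "?R = (\<Union>(i, j, k) \<in> {(i, j, k). {i, j, k} = {1, 2, 4}}. quad ` D4_nonroots (D4_coords i) (D4_coords j) (D4_coords k))"
    unfolding perms by (simp only: UN_insert UN_empty prod.case D4_nonroots_def image_insert image_empty Let_def
      quad_add quad_diff quad_minus basis[symmetric] insert_iff simp_thms scaleR_2)
  also have "\<dots> = quad ` (\<Union>(i, j, k) \<in> {(i, j, k). {i, j, k} = {1, 2, 4}}.
      D4_nonroots (D4_coords i) (D4_coords j) (D4_coords k))"
    by (simp add: image_UN case_prod_unfold)
  also have "\<dots> = nonroot_screeners L"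
    unfolding perms nonroot_screeners_eq_quad D4_nonroots_Union ..
  finally show ?thesis ..
qed

lemma card_nonroot_screeners_D4: "card (nonroot_screeners L) = 24"
proof -
  have "inj quad" by (simp add: inj_def quad_eq_iff)
  then show ?thesis
    unfolding nonroot_screeners_eq_quad card_image[OF inj_on_subset[OF \<open>inj quad\<close> subset_UNIV]]
      sum_four_squares_eq_4_same_parity by simp
qed

lemma screeners_type_F4: "root_system_of_type (screeners L) 4 cartan_F4"
proof -
  \<comment> \<open>Two long roots of norm 4 followed by the short roots \<open>\<alpha> 3\<close>
    and \<open>\<alpha> 4\<close>; the double bond joins the second and the third.\<close>
  define \<delta> where "\<delta> i = (if i = 1 then quad (1, 1, 1, 1) else if i = 2 then quad (0, -2, 0, 0)
    else if i = 3 then quad (0, 1, -1, 0) else quad (0, 0, 1, -1))" for i :: nat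
  have four': "{1..4} = {1, 2, 3, 4 :: nat}" by auto
  have "simple_roots (screeners L) n \<delta>"
  proof (rule simple_rootsI[OF basis basis_subset_screeners])
    have "quad (1, 1, 1, 1) \<in> nonroot_screeners L" "quad (0, -2, 0, 0) \<in> nonroot_screeners L"
      unfolding nonroot_screeners_eq_quad by (intro imageI; simp)+
    moreover have "\<alpha> 3 \<in> screeners L" "\<alpha> 4 \<in> screeners L"
      using basis_subset_screeners four by auto
    ultimately show "\<delta> ` {1..n} \<subseteq> screeners L"
      unfolding four by (simp add: \<delta>_def nonroot_screeners_def basis_eq_quad)
  next
    fix v assume v: "v \<in> screeners L"
    then have "v \<in> L" by (simp add: mem_screeners_iff[OF integral])
    then obtain x where x: "v = comb x" "even (sum x {1..n})"
      unfolding L_eq by blast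
    obtain s where "sum x {1..n} = 2 * s" using x(2) by (rule evenE)
    \<comment> \<open>The expansion needs half of \<open>3 * x 1 - x 2 - x 3 - x 4\<close>. This
      number is \<open>4 * x 1\<close> minus the coordinate sum \<open>2 * s\<close>, hence
      even.\<close>
    moreover define k where "k = 2 * x 1 - s"
    ultimately have k: "3 * x 1 - x 2 - x 3 - x 4 = 2 * k" unfolding four by simp
    define c where "c i = (if i = 1 then x 1 else if i = 2 then k
      else if i = 3 then 2 * x 1 - x 3 - x 4 else x 1 - x 4)" for i :: nat
    have "(\<Sum>i=1..n. of_int (c i) *\<^sub>R \<delta> i) = of_int (c 1) *\<^sub>R quad (1, 1, 1, 1) +
        (of_int (c 2) *\<^sub>R quad (0, -2, 0, 0) +
        (of_int (c 3) *\<^sub>R quad (0, 1, -1, 0) + of_int (c 4) *\<^sub>R quad (0, 0, 1, -1)))"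
      unfolding four by (simp add: \<delta>_def)
    also have "\<dots> = v"
      unfolding x(1) comb_eq_quad quad_arith quad_eq_iff using k by (simp add: c_def)
    finally have "v = (\<Sum>i=1..n. of_int (c i) *\<^sub>R \<delta> i)" by simp
    moreover have "(\<forall>i\<in>{1..n}. 0 \<le> c i) \<or> (\<forall>i\<in>{1..n}. c i \<le> 0)"
    proof -
      have "(x 1)\<^sup>2 + (x 2)\<^sup>2 + (x 3)\<^sup>2 + (x 4)\<^sup>2 = 2 \<or> (x 1)\<^sup>2 + (x 2)\<^sup>2 + (x 3)\<^sup>2 + (x 4)\<^sup>2 = 4
          \<and> even (x 1 + x 2) \<and> even (x 1 + x 3) \<and> even (x 1 + x 4)"
        using screener_norm[of x] v x(1) unfolding four by (simp add: add.assoc) blast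
      then show ?thesis
        using F4_coefficients_same_sign[of "x 1" "x 2" "x 3" "x 4" k] k
        unfolding four by (simp add: c_def)
    qed
    ultimately show "\<exists>c :: nat \<Rightarrow> int. v = (\<Sum>i=1..n. of_int (c i) *\<^sub>R \<delta> i) \<and>
        ((\<forall>i\<in>{1..n}. 0 \<le> c i) \<or> (\<forall>i\<in>{1..n}. c i \<le> 0))"
      by blast
  qed
  moreover have "2 * (\<delta> i \<bullet> \<delta> j) / (\<delta> j \<bullet> \<delta> j) = of_int (cartan_F4 i j)"
    if "i \<in> {1..4}" "j \<in> {1..4}" for i j
  proof -
    have "e i \<bullet> e j = (if i = j then 1 else 0)" if "i \<in> {1, 2, 3, 4}" "j \<in> {1, 2, 3, 4}" for i j
      using that unfolding four[symmetric] by (rule orthonormal)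
    then have "quad (a, b, c, d) \<bullet> quad (a', b', c', d') = of_int (a * a' + b * b' + c * c' + d * d')"
      for a b c d a' b' c' d'
      by (simp add: quad_def inner_add_left inner_add_right)
    then show ?thesis
      using that unfolding four' by (elim insertE emptyE) (simp_all add: \<delta>_def cartan_F4_def)
  qed
  ultimately show ?thesis
    unfolding root_system_of_type_def using root_system_screeners[OF integral] n_eq_4 by blast
qed

end

end

section \<open>Type G\<close>

text \<open>The form is half the norm of a vector of A_2 in simple root coordinates. Completing the
  square writes four times the form as a square plus three times \<open>x\<^sup>2\<close>, and
  likewise for \<open>y\<close>.\<close>

lemma A2_form_bound:
  fixes x y :: int
  assumes "x\<^sup>2 - x * y + y\<^sup>2 \<le> 3"
  shows "x \<in> {-2, -1, 0, 1, 2} \<and> y \<in> {-2, -1, 0, 1, 2}"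
proof -
  have bound: "p \<le> 4" if "4 * m = s + 3 * p" "m \<le> 3" "0 \<le> s" for m s p :: int
    using that by linarith
  have "4 * (x\<^sup>2 - x * y + y\<^sup>2) = (2 * y - x)\<^sup>2 + 3 * x\<^sup>2"
    "4 * (x\<^sup>2 - x * y + y\<^sup>2) = (2 * x - y)\<^sup>2 + 3 * y\<^sup>2"
    by (simp_all add: power2_eq_square algebra_simps)
  then have "x\<^sup>2 \<le> 4" "y\<^sup>2 \<le> 4"
    using bound[OF _ assms zero_le_power2] by blast+
  then show ?thesis by (intro conjI square_le_4_cases)
qed

lemma A2_form_eq_3:
  "{(x, y). x\<^sup>2 - x * y + y\<^sup>2 = (3 :: int)} = {(1, -1), (-1, 1), (1, 2), (-1, -2), (2, 1), (-2, -1)}"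
    (is "?S = ?T")
proof
  show "?S \<subseteq> ?T"
  proof
    fix t assume "t \<in> ?S"
    then obtain x y where t: "t = (x, y)" and eq: "x\<^sup>2 - x * y + y\<^sup>2 = 3" by blast
    have "x \<in> {-2, -1, 0, 1, 2}" "y \<in> {-2, -1, 0, 1, 2}"
      using A2_form_bound[of x y] eq by auto
    then show "t \<in> ?T"
      unfolding t using eq by (elim insertE emptyE) simp_all
  qed
  show "?T \<subseteq> ?S" by simp
qed

locale A2_frame =
  fixes L :: "'a::real_inner set" and \<alpha> :: "nat \<Rightarrow> 'a"
  assumes D2: "D_lattice L 2 \<alpha>"
begin

lemma basis: "lattice_basis L 2 \<alpha>"
  using D2 by (simp add: D_lattice_def A_lattice_def)

lemma integral: "integral_lattice L"
  using D2 by (rule D_lattice_integral)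

lemma two: "{1..2} = {1, 2 :: nat}"
  by auto

lemma gram: "\<alpha> 1 \<bullet> \<alpha> 1 = 2" "\<alpha> 2 \<bullet> \<alpha> 2 = 2" "\<alpha> 1 \<bullet> \<alpha> 2 = -1" "\<alpha> 2 \<bullet> \<alpha> 1 = -1"
  using D2 unfolding D_lattice_def A_lattice_def two by (simp_all add: gram_A_def)

text \<open>The simplifier rewrites the index \<open>1\<close> to \<open>Suc 0\<close>, so the Gram
  entries are also recorded in that form.\<close>

lemmas gram_simps = gram[unfolded One_nat_def]

definition pair :: "int \<times> int \<Rightarrow> 'a" where
  "pair = (\<lambda>(x, y). of_int x *\<^sub>R \<alpha> 1 + of_int y *\<^sub>R \<alpha> 2)"

lemma L_eq: "L = range pair"
proof (intro equalityI subsetI)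
  fix v assume "v \<in> L"
  then obtain c :: "nat \<Rightarrow> int" where "v = (\<Sum>i=1..2. of_int (c i) *\<^sub>R \<alpha> i)"
    using basis by (auto simp: lattice_basis_def)
  then have "v = pair (c 1, c 2)" unfolding two by (simp add: pair_def)
  then show "v \<in> range pair" by blast
next
  fix v assume "v \<in> range pair"
  then obtain x y where v: "v = pair (x, y)" by auto
  show "v \<in> L"
    by (rule lattice_basis_memI[OF basis, where c = "\<lambda>i. if i = 1 then x else y"])
      (unfold two, simp add: v pair_def)
qed

lemma inner_pair: "pair (x, y) \<bullet> pair (u, v) = of_int (2 * x * u - x * v - y * u + 2 * y * v)"
  by (simp add: pair_def inner_add_left inner_add_right gram_simps algebra_simps)

lemma norm_pair: "pair (x, y) \<bullet> pair (x, y) = of_int (2 * (x\<^sup>2 - x * y + y\<^sup>2))"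
  unfolding inner_pair by (simp add: power2_eq_square)

lemma pair_scale: "2 *\<^sub>R pair (x, y) = pair (2 * x, 2 * y)"
  by (simp add: pair_def algebra_simps)

text \<open>Pairing the difference with both simple roots gives a linear system whose matrix is the
  Gram matrix, of determinant 3.\<close>

lemma inj_pair: "inj pair"
proof (rule injI)
  fix s t assume eq: "pair s = pair t"
  obtain x y u v where st: "s = (x, y)" "t = (u, v)" by (metis surj_pair)
  have "(pair s - pair t) \<bullet> \<alpha> 1 = 0" "(pair s - pair t) \<bullet> \<alpha> 2 = 0"
    using eq by simp_all
  then have "of_int (2 * (x - u) - (y - v)) = (0 :: real)" "of_int (2 * (y - v) - (x - u)) = (0 :: real)"
    unfolding st by (simp_all add: pair_def inner_diff_left inner_add_left gram_simps)
  then have "2 * (x - u) - (y - v) = 0" "2 * (y - v) - (x - u) = 0"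
    by (simp_all only: of_int_eq_0_iff)
  then show "s = t" unfolding st by auto
qed

text \<open>
  With \<open>\<langle>\<beta>,\<beta>\<rangle> = 2M\<close>, the pairings \<open>p\<close>, \<open>q\<close> of \<open>2\<beta>/\<langle>\<beta>,\<beta>\<rangle>\<close> with the simple roots satisfy
  \<open>M (p\<^sup>2 + p q + q\<^sup>2) = 3\<close>.
\<close>

lemma screener_norm:
  assumes "pair (x, y) \<in> screeners L"
  shows "x\<^sup>2 - x * y + y\<^sup>2 = 1 \<or> x\<^sup>2 - x * y + y\<^sup>2 = 3"
proof -
  define M where "M = x\<^sup>2 - x * y + y\<^sup>2"
  have norm: "pair (x, y) \<bullet> pair (x, y) = 2 * of_int M"
    unfolding norm_pair M_def by simp
  have "pair (x, y) \<noteq> 0" using assms zero_notin_screeners[OF integral] by auto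
  then have "0 < pair (x, y) \<bullet> pair (x, y)" by simp
  then have "M > 0" unfolding norm by simp
  have int: "2 * (w \<bullet> pair (x, y)) / (pair (x, y) \<bullet> pair (x, y)) \<in> \<int>" if "w \<in> L" for w
    using assms that unfolding mem_screeners_iff[OF integral] by blast
  have "\<exists>p. 2 * u * x - u * y - v * x + 2 * v * y = M * p" for u v
  proof -
    have "2 * (pair (u, v) \<bullet> pair (x, y)) / (pair (x, y) \<bullet> pair (x, y)) \<in> \<int>"
      by (rule int) (simp add: L_eq)
    then obtain p where "2 * (pair (u, v) \<bullet> pair (x, y)) / (pair (x, y) \<bullet> pair (x, y)) = of_int p"
      by (rule Ints_cases)
    then have "pair (u, v) \<bullet> pair (x, y) = of_int M * of_int p"
      using \<open>M > 0\<close> unfolding norm by (simp add: field_simps)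
    then have "of_int (2 * u * x - u * y - v * x + 2 * v * y) = (of_int (M * p) :: real)"
      unfolding inner_pair by simp
    then show ?thesis unfolding of_int_eq_iff by blast
  qed
  from this[of 1 0] this[of 0 1] obtain p q where pq: "2 * x - y = M * p" "2 * y - x = M * q"
    by auto
  \<comment> \<open>The Gram matrix is inverted up to its determinant 3. The form at
    \<open>(3 * x, 3 * y)\<close> is then computed twice: from \<open>p\<close> and
    \<open>q\<close>, and as \<open>9 * M\<close>.\<close>
  then have "3 * x = M * (2 * p + q)" "3 * y = M * (p + 2 * q)"
    by (simp_all add: algebra_simps)
  then have "(3 * x)\<^sup>2 - (3 * x) * (3 * y) + (3 * y)\<^sup>2 = 3 * M * (M * (p\<^sup>2 + p * q + q\<^sup>2))"
    by (simp add: power2_eq_square algebra_simps)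
  moreover have "(3 * x)\<^sup>2 - (3 * x) * (3 * y) + (3 * y)\<^sup>2 = 3 * M * 3"
    unfolding M_def by (simp add: power2_eq_square algebra_simps)
  ultimately have "M * (p\<^sup>2 + p * q + q\<^sup>2) = 3" using \<open>M > 0\<close> by simp
  then have "M dvd 3" by (metis dvd_triv_left)
  then have "M \<le> 3" by (rule zdvd_imp_le) simp
  then have "M = 1 \<or> M = 2 \<or> M = 3" using \<open>M > 0\<close> by presburger
  then have "M = 1 \<or> M = 3" using \<open>M dvd 3\<close> by auto
  then show ?thesis by (simp add: M_def)
qed

text \<open>At norm 6 the dual condition says that 3 divides all pairings with \<open>L\<close>,
  which suffices on the two simple roots and is read off from the six solutions. Each solution has
  an odd coordinate, hence is not in \<open>2L\<close>.\<close>

lemma nonroot_screeners_eq_pair: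
  "nonroot_screeners L = pair ` {(x, y). x\<^sup>2 - x * y + y\<^sup>2 = 3}" (is "_ = pair ` ?S")
proof (intro equalityI subsetI)
  fix w assume w: "w \<in> nonroot_screeners L"
  then have "w \<in> L" "w \<in> screeners L" "w \<bullet> w \<noteq> 2"
    by (auto simp: nonroot_screeners_def lattice_roots_def mem_screeners_iff[OF integral])
  then obtain x y where xy: "w = pair (x, y)" by (auto simp: L_eq)
  have "x\<^sup>2 - x * y + y\<^sup>2 \<noteq> 1"
  proof
    assume "x\<^sup>2 - x * y + y\<^sup>2 = 1"
    then have "w \<bullet> w = 2" unfolding xy norm_pair by (simp only:)
    with \<open>w \<bullet> w \<noteq> 2\<close> show False ..
  qed
  then show "w \<in> pair ` ?S"
    using screener_norm[of x y] \<open>w \<in> screeners L\<close> xy by auto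
next
  fix w assume "w \<in> pair ` ?S"
  then obtain x y where xy: "w = pair (x, y)" "x\<^sup>2 - x * y + y\<^sup>2 = 3" by blast
  have norm: "w \<bullet> w = 6" unfolding xy norm_pair by simp
  have list: "(x, y) \<in> {(1, -1), (-1, 1), (1, 2), (-1, -2), (2, 1), (-2, -1)}"
    using xy(2) unfolding A2_form_eq_3[symmetric] by simp
  have "w \<noteq> 2 *\<^sub>R pair (u, v)" for u v
  proof
    assume "w = 2 *\<^sub>R pair (u, v)"
    then have "x = 2 * u" "y = 2 * v"
      unfolding xy pair_scale inj_eq[OF inj_pair] by simp_all
    then have "even x" "even y" by simp_all
    then show False using list by auto
  qed
  moreover have "2 * (pair (u, v) \<bullet> w) / (w \<bullet> w) \<in> \<int>" for u v
  proof -
    have "3 dvd 2 * u * x - u * y - v * x + 2 * v * y"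
    proof -
      have "3 dvd 2 * x - y" "3 dvd 2 * y - x"
        using list by (elim insertE emptyE; simp)+
      then have "3 dvd u * (2 * x - y) + v * (2 * y - x)"
        by (intro dvd_add dvd_mult)
      then show ?thesis by (simp add: algebra_simps)
    qed
    then obtain k where k: "2 * u * x - u * y - v * x + 2 * v * y = 3 * k" by (rule dvdE)
    have "2 * (pair (u, v) \<bullet> w) / (w \<bullet> w) = of_int k"
      unfolding norm unfolding xy(1) inner_pair k by simp
    then show ?thesis by simp
  qed
  moreover have "\<exists>k::int. w \<bullet> w = 2 * of_int k"
    using norm by (intro exI[of _ 3]) simp
  ultimately have "w \<in> screeners L"
    unfolding mem_screeners_iff[OF integral] using xy(1) by (auto simp: L_eq)
  then show "w \<in> nonroot_screeners L"
    using norm by (simp add: nonroot_screeners_def lattice_roots_def)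
qed

lemma nonroot_screeners_A2:
  "nonroot_screeners L =
    {\<alpha> 1 - \<alpha> 2, - (\<alpha> 1 - \<alpha> 2), \<alpha> 1 + 2 *\<^sub>R \<alpha> 2, - (\<alpha> 1 + 2 *\<^sub>R \<alpha> 2),
     2 *\<^sub>R \<alpha> 1 + \<alpha> 2, - (2 *\<^sub>R \<alpha> 1 + \<alpha> 2)}"
proof -
  have "pair (1, -1) = \<alpha> 1 - \<alpha> 2" "pair (-1, 1) = - (\<alpha> 1 - \<alpha> 2)"
    "pair (1, 2) = \<alpha> 1 + 2 *\<^sub>R \<alpha> 2" "pair (-1, -2) = - (\<alpha> 1 + 2 *\<^sub>R \<alpha> 2)"
    "pair (2, 1) = 2 *\<^sub>R \<alpha> 1 + \<alpha> 2" "pair (-2, -1) = - (2 *\<^sub>R \<alpha> 1 + \<alpha> 2)"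
    by (simp_all add: pair_def algebra_simps)
  then show ?thesis
    unfolding nonroot_screeners_eq_pair A2_form_eq_3 image_insert image_empty by (simp only:)
qed

lemma card_nonroot_screeners_A2: "card (nonroot_screeners L) = 6"
  unfolding nonroot_screeners_eq_pair card_image[OF inj_on_subset[OF inj_pair subset_UNIV]] A2_form_eq_3
  by simp

lemma norm_nonroot_screener: "v \<in> nonroot_screeners L \<Longrightarrow> v \<bullet> v = 6"
  unfolding nonroot_screeners_eq_pair by (clarify, simp only: norm_pair)

lemma screeners_type_G2: "root_system_of_type (screeners L) 2 cartan_G2"
proof -
  \<comment> \<open>The short root \<open>\<alpha> 1\<close> and the long root
    \<open>\<alpha> 2 - \<alpha> 1\<close> of norm 6, with pairing -3. In this base the coefficients
    of \<open>pair (x, y)\<close> are \<open>x + y\<close> and \<open>y\<close>.\<close>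
  define \<delta> where "\<delta> i = (if i = 1 then pair (1, 0) else pair (-1, 1))" for i :: nat
  have roots: "\<alpha> ` {1..2} \<subseteq> screeners L"
    using lattice_roots_subset_screeners[OF integral] lattice_basis_mem[OF basis] gram
    unfolding two by (auto simp: lattice_roots_def)
  have "simple_roots (screeners L) 2 \<delta>"
  proof (rule simple_rootsI[OF basis roots])
    have "pair (-1, 1) \<in> nonroot_screeners L"
      unfolding nonroot_screeners_eq_pair by (intro imageI) simp
    moreover have "pair (1, 0) \<in> screeners L"
      using roots unfolding two by (simp add: pair_def)
    ultimately show "\<delta> ` {1..2} \<subseteq> screeners L"
      unfolding two by (simp add: \<delta>_def nonroot_screeners_def)
  next
    fix v assume v: "v \<in> screeners L"
    then have "v \<in> L" by (simp add: mem_screeners_iff[OF integral])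
    then obtain x y where xy: "v = pair (x, y)"
      unfolding L_eq by auto
    define c where "c i = (if i = 1 then x + y else y)" for i :: nat
    have "v = (\<Sum>i=1..2. of_int (c i) *\<^sub>R \<delta> i)"
      unfolding xy two by (simp add: c_def \<delta>_def pair_def algebra_simps)
    moreover have "0 \<le> x + y \<and> 0 \<le> y \<or> x + y \<le> 0 \<and> y \<le> 0"
    proof -
      have eq: "x\<^sup>2 - x * y + y\<^sup>2 = 1 \<or> x\<^sup>2 - x * y + y\<^sup>2 = 3"
        using screener_norm v xy by simp
      then have "x \<in> {-2, -1, 0, 1, 2}" "y \<in> {-2, -1, 0, 1, 2}"
        using A2_form_bound[of x y] by auto
      then show ?thesis
        using eq by (elim insertE emptyE) simp_all
    qed
    ultimately show "\<exists>c :: nat \<Rightarrow> int. v = (\<Sum>i=1..2. of_int (c i) *\<^sub>R \<delta> i) \<and>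
        ((\<forall>i\<in>{1..2}. 0 \<le> c i) \<or> (\<forall>i\<in>{1..2}. c i \<le> 0))"
      unfolding two by (intro exI[of _ c]) (auto simp: c_def)
  qed
  moreover have "2 * (\<delta> i \<bullet> \<delta> j) / (\<delta> j \<bullet> \<delta> j) = of_int (cartan_G2 i j)"
    if "i \<in> {1..2}" "j \<in> {1..2}" for i j
    using that unfolding two
    by (elim insertE emptyE) (simp_all add: \<delta>_def cartan_G2_def inner_pair)
  ultimately show ?thesis
    unfolding root_system_of_type_def using root_system_screeners[OF integral] by blast
qed

end

section \<open>The classification\<close>

text \<open>For n = 3 the fork is the chain \<open>\<alpha> 1\<close>, \<open>\<alpha> 3\<close>,
  \<open>\<alpha> 2\<close>, so exchanging the last two indices gives the numbering of type
  A.\<close>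

lemma D3_is_A3:
  assumes "D_lattice L 3 \<alpha>"
  shows "\<exists>\<gamma>. A_lattice L 3 \<gamma>"
proof -
  define \<gamma> where "\<gamma> i = \<alpha> (if i = 2 then 3 else if i = 3 then 2 else i)" for i :: nat
  have three: "{1..3} = {1, 2, 3 :: nat}" by auto
  have basis: "lattice_basis L 3 \<alpha>" and gram: "\<forall>i\<in>{1..3}. \<forall>j\<in>{1..3}. \<alpha> i \<bullet> \<alpha> j = gram_D i j"
    using assms by (simp_all add: D_lattice_def)
  have \<gamma>: "\<gamma> 1 = \<alpha> 1" "\<gamma> 2 = \<alpha> 3" "\<gamma> 3 = \<alpha> 2" by (simp_all add: \<gamma>_def)
  note \<gamma> = \<gamma> \<gamma>(1)[unfolded One_nat_def]
  have "lattice_basis L 3 \<gamma>"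
    unfolding lattice_basis_def
  proof (intro conjI equalityI subsetI)
    show "inj_on \<gamma> {1..3}"
      using basis unfolding lattice_basis_def three by (auto simp: \<gamma>)
    have "\<gamma> ` {1..3} = \<alpha> ` {1..3}"
      unfolding three by (auto simp: \<gamma>)
    then show "independent (\<gamma> ` {1..3})"
      using basis by (simp add: lattice_basis_def)
  next
    fix v assume "v \<in> L"
    then obtain c :: "nat \<Rightarrow> int" where "v = (\<Sum>i=1..3. of_int (c i) *\<^sub>R \<alpha> i)"
      using basis by (auto simp: lattice_basis_def)
    \<comment> \<open>The coefficients are permuted by the same transposition as the basis; being an
      involution, it also serves for the converse below.\<close>
    then have "v = (\<Sum>i=1..3. of_int ((c(2 := c 3, 3 := c 2)) i) *\<^sub>R \<gamma> i)"
      unfolding three by (simp add: \<gamma>)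
    then show "v \<in> {\<Sum>i=1..3. of_int (c i) *\<^sub>R \<gamma> i |c :: nat \<Rightarrow> int. True}"
      by blast
  next
    fix v assume "v \<in> {\<Sum>i=1..3. of_int (c i) *\<^sub>R \<gamma> i |c :: nat \<Rightarrow> int. True}"
    then obtain c :: "nat \<Rightarrow> int" where "v = (\<Sum>i=1..3. of_int (c i) *\<^sub>R \<gamma> i)" by blast
    then have "v = (\<Sum>i=1..3. of_int ((c(2 := c 3, 3 := c 2)) i) *\<^sub>R \<alpha> i)"
      unfolding three by (simp add: \<gamma>)
    then show "v \<in> L"
      by (rule lattice_basis_memI[OF basis])
  qed
  moreover have "\<forall>i\<in>{1..3}. \<forall>j\<in>{1..3}. \<gamma> i \<bullet> \<gamma> j = gram_A i j"
    using gram unfolding three by (simp add: \<gamma> gram_A_def gram_D_def doubleton_eq_iff)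
  ultimately show ?thesis
    unfolding A_lattice_def by blast
qed

theorem theorem5p15:
  fixes L :: "'a::real_inner set" and n :: nat and \<alpha> :: "nat \<Rightarrow> 'a"
  assumes "n \<ge> 2" and "D_lattice L n \<alpha>"
  shows
    "nonroot_screeners L \<noteq> {} \<and>
     (\<forall>\<beta>\<in>nonroot_screeners L. \<beta> \<bullet> \<beta> = (if n = 2 then 6 else 4)) \<and>
     (n = 2 \<longrightarrow>
        card (nonroot_screeners L) = 6 \<and>
        nonroot_screeners L =
          {\<alpha> 1 - \<alpha> 2, - (\<alpha> 1 - \<alpha> 2),
           \<alpha> 1 + 2 *\<^sub>R \<alpha> 2, - (\<alpha> 1 + 2 *\<^sub>R \<alpha> 2),
           2 *\<^sub>R \<alpha> 1 + \<alpha> 2, - (2 *\<^sub>R \<alpha> 1 + \<alpha> 2)} \<and>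
        root_system_of_type (nonroot_screeners L \<union> lattice_roots L) 2 cartan_G2) \<and>
     (n = 3 \<longrightarrow>
        (\<exists>\<gamma>. A_lattice L 3 \<gamma>) \<and>
        card (nonroot_screeners L) = 6 \<and>
        nonroot_screeners L =
          {\<alpha> 1 + \<alpha> 2, - (\<alpha> 1 + \<alpha> 2),
           \<alpha> 1 - \<alpha> 2, - (\<alpha> 1 - \<alpha> 2),
           \<alpha> 1 + \<alpha> 2 + 2 *\<^sub>R \<alpha> 3, - (\<alpha> 1 + \<alpha> 2 + 2 *\<^sub>R \<alpha> 3)} \<and>
        root_system_of_type (nonroot_screeners L \<union> lattice_roots L) 3 (cartan_C 3)) \<and>
     (n = 4 \<longrightarrow>
        card (nonroot_screeners L) = 24 \<and>
        nonroot_screeners L =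
          (\<Union>(i, j, k) \<in> {(i, j, k). {i, j, k} = {1, 2, 4}}.
             {\<alpha> i + \<alpha> j, - (\<alpha> i + \<alpha> j),
              \<alpha> i - \<alpha> j,
              2 *\<^sub>R \<alpha> i + \<alpha> j + 2 *\<^sub>R \<alpha> 3 + \<alpha> k,
              - (2 *\<^sub>R \<alpha> i + \<alpha> j + 2 *\<^sub>R \<alpha> 3 + \<alpha> k),
              \<alpha> i + 2 *\<^sub>R \<alpha> 3 + \<alpha> j, - (\<alpha> i + 2 *\<^sub>R \<alpha> 3 + \<alpha> j)}) \<and>
        root_system_of_type (nonroot_screeners L \<union> lattice_roots L) 4 cartan_F4) \<and>
     (n > 4 \<longrightarrow>
        card (nonroot_screeners L) = 2 * n \<and>
        nonroot_screeners L =
          {\<alpha> 1 + \<alpha> 2, - (\<alpha> 1 + \<alpha> 2), \<alpha> 1 - \<alpha> 2, - (\<alpha> 1 - \<alpha> 2)} \<union>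
          (\<Union>j\<in>{3..n}.
             {\<alpha> 1 + \<alpha> 2 + 2 *\<^sub>R (\<Sum>i=3..j. \<alpha> i),
              - (\<alpha> 1 + \<alpha> 2 + 2 *\<^sub>R (\<Sum>i=3..j. \<alpha> i))}) \<and>
        root_system_of_type (nonroot_screeners L \<union> lattice_roots L) n (cartan_C n))"
proof -
  have integral: "integral_lattice L"
    using assms(2) by (rule D_lattice_integral)
  \<comment> \<open>The three type lemmas are stated for all screeners; this rewrites the unions in
    the theorem to that form.\<close>
  note Un = nonroot_screeners_Un_lattice_roots[OF integral]
  show ?thesis
  proof (cases "n = 2")
    case True
    then interpret A2_frame L \<alpha>
      using assms(2) by unfold_locales simp
    show ?thesis
      unfolding Un using True nonroot_screeners_A2 card_nonroot_screeners_A2 screeners_type_G2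
        norm_nonroot_screener by auto
  next
    case False
    then obtain e where "D_frame L n \<alpha> e"
      using assms D_frame_exists[of n L \<alpha>] by auto
    then interpret D_frame L n \<alpha> e .
    have norm: "\<forall>\<beta>\<in>nonroot_screeners L. \<beta> \<bullet> \<beta> = (if n = 2 then 6 else 4)"
      using norm_nonroot_screener False by simp
    have nonempty: "nonroot_screeners L \<noteq> {}"
      using two_e_nonroot_screener[of 1 2] n_ge_3 by auto
    show ?thesis
    proof (cases "n = 4")
      case True
      show ?thesis
        unfolding Un using True norm nonempty nonroot_screeners_D4 card_nonroot_screeners_D4 screeners_type_F4
        by simp
    next
      case False
      note eq = nonroot_screeners_eq_axes[OF False]
      have card: "card (nonroot_screeners L) = 2 * n"
        unfolding eq by (rule card_axes)
      \<comment> \<open>For \<open>n = 3\<close> the union over \<open>{3..n}\<close> has the single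
        index 3, and its inner sum is \<open>\<alpha> 3\<close>.\<close>
      have eq3: "nonroot_screeners L =
          {\<alpha> 1 + \<alpha> 2, - (\<alpha> 1 + \<alpha> 2), \<alpha> 1 - \<alpha> 2, - (\<alpha> 1 - \<alpha> 2),
           \<alpha> 1 + \<alpha> 2 + 2 *\<^sub>R \<alpha> 3, - (\<alpha> 1 + \<alpha> 2 + 2 *\<^sub>R \<alpha> 3)}" if "n = 3"
        unfolding eq axes_in_basis using that by (simp add: insert_commute)
      have A3: "\<exists>\<gamma>. A_lattice L 3 \<gamma>" if "n = 3"
        using D3_is_A3 D that by blast
      show ?thesis
        unfolding Un using \<open>n \<noteq> 2\<close> False norm nonempty card eq3 A3 eq[unfolded axes_in_basis]
          screeners_type_C[OF False] by (intro conjI impI) simp_all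
    qed
  qed
qed

end
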